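(* Let $g:\mathbb{R}^d\to\mathbb{R}$ satisfy: (g-i) $g$ is continuously differentiable and non-negative; (g-ii) $\|\nabla g(\theta)-\nabla g(\theta')\|\le L\|\theta-\theta'\|$ for all $\theta,\theta'\in\mathbb{R}^d$; (g-iii) there exists $\eta>0$ such that $\liminf_{\|\theta\|\to+\infty}\|\nabla g(\theta)\|^2>\eta$; (g-iv) $g$ is coercive: $\lim_{\|\theta\|\to+\infty}g(\theta)=+\infty$; (g-v) the critical value set $\{g(\theta)\mid\nabla g(\theta)=0\}$ is nowhere dense in $\mathbb{R}$. Let $\{\theta_n\}_{n\ge1}$ be generated by AdaGrad-Norm, and suppose that for all $n\ge 1$: (n-i) $\mathbb{E}[\nabla g(\theta_n,\xi_n)\mid\mathscr{F}_{n-1}]=\nabla g(\theta_n)$; (n-ii) $\mathbb{E}[\|\nabla g(\theta_n,\xi_n)\|^2\mid\mathscr{F}_{n-1}]\le\sigma_0\|\nabla g(\theta_n)\|^2+\sigma_1$ for some constants $\sigma_0,\sigma_1\ge0$; (n-iii) for some constants $D_0,D_1>0$, for any $\theta_n$ satisfying $\|\nabla g(\theta_n)\|^2<D_0$ one has $\|\nabla g(\theta_n,\xi_n)\|^2<D_1$ almost surely. Then for any initial point $\theta_1\in\mathbb{R}^d$ and any $S_0>0$, $$\lim_{n\to\infty}\|\nabla g(\theta_n)\|=0\quad\text{almost surely.}$$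
   Context: AdaGrad-Norm: given an initial point $\theta_1\in\mathbb{R}^d$ and constants $S_0>0$, $\alpha_0>0$, for $n\ge1$ $$S_n=S_{n-1}+\|\nabla g(\theta_n,\xi_n)\|^2,\qquad \theta_{n+1}=\theta_n-\frac{\alpha_0}{\sqrt{S_n}}\nabla g(\theta_n,\xi_n).$$ Here $\{\xi_n\}_{n\ge1}$ is a sequence of independent random variables and $\nabla g(\theta_n,\xi_n)\in\mathbb{R}^d$ is the random vector (stochastic gradient) returned by a stochastic first-order oracle at $\theta_n$ with noise $\xi_n$. The filtration is $\mathscr{F}_n=\sigma\{\theta_1,\xi_1,\dots,\xi_n\}$ for $n\ge1$ and $\mathscr{F}_0=\{\emptyset,\Omega\}$. *)

theory Defs
  imports "HOL-Probability.Probability"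
begin

definition nowhere_dense :: "'a::topological_space set \<Rightarrow> bool" where
  "nowhere_dense A \<longleftrightarrow> interior (closure A) = {}"

text \<open>The sigma-algebra generated by the initial point and \<open>\<xi> 1, \<dots>, \<xi> n\<close>. The initial point is
  deterministic, so its preimages are only the empty set and \<open>space M\<close>, and it does not appear.
  For \<open>n = 0\<close> this is the trivial sigma-algebra.\<close>

definition noise_filtration ::
    "'w measure \<Rightarrow> 'x measure \<Rightarrow> (nat \<Rightarrow> 'w \<Rightarrow> 'x) \<Rightarrow> nat \<Rightarrow> 'w measure" where
  "noise_filtration M N \<xi> n =
     sigma (space M) (\<Union>k\<in>{1..n}. {\<xi> k -` A \<inter> space M | A. A \<in> sets N})"

lemma space_noise_filtration [simp]: "space (noise_filtration M N \<xi> n) = space M"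
  unfolding noise_filtration_def by (rule space_measure_of) auto

lemma sets_noise_filtration:
  "sets (noise_filtration M N \<xi> n) =
     sigma_sets (space M) (\<Union>k\<in>{1..n}. {\<xi> k -` A \<inter> space M | A. A \<in> sets N})"
  unfolding noise_filtration_def by (rule sets_measure_of) auto

lemma sets_noise_filtration_0: "sets (noise_filtration M N \<xi> 0) = {{}, space M}"
  by (simp add: sets_noise_filtration sigma_sets_empty_eq)

lemma subalgebra_noise_filtration:
  assumes "\<And>k. k \<ge> 1 \<Longrightarrow> \<xi> k \<in> measurable M N"
  shows "subalgebra M (noise_filtration M N \<xi> n)"
  unfolding subalgebra_def sets_noise_filtration
  using assms by (auto intro!: sets.sigma_sets_subset measurable_sets)

text \<open>Coordinatewise conditional expectation. As with \<open>real_cond_exp\<close>, it has its usual meaning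
  only for integrable arguments; for the stochastic gradients, square-integrability follows from the
  second-moment condition, which is therefore stated with the extended-valued \<open>nn_cond_exp\<close>: where the
  conditional second moment is infinite, \<open>real_cond_exp\<close> would return \<open>0\<close>.\<close>

definition vec_cond_exp ::
    "'w measure \<Rightarrow> 'w measure \<Rightarrow> ('w \<Rightarrow> 'a::euclidean_space) \<Rightarrow> 'w \<Rightarrow> 'a" where
  "vec_cond_exp M F f = (\<lambda>\<omega>. \<Sum>b\<in>Basis. real_cond_exp M F (\<lambda>\<omega>'. f \<omega>' \<bullet> b) \<omega> *\<^sub>R b)"

end

theory Submission
  imports Defs
begin

text \<open>Write \<open>x k\<close>, \<open>v k\<close> and \<open>s k\<close> for the iterate, the stochastic gradient used at it, and the accumulated squared
gradients before that step, so that the step is \<open>- (\<alpha> / sqrt (s (Suc k))) v k\<close>. The proof extracts from the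
probabilistic hypotheses a few almost sure summability properties of the trajectory, and then argues
deterministically about every trajectory that has them.

Summability (\<open>lyapunov_step\<close>, \<open>lyapunov_expectation_step\<close>). Divide the objective by \<open>sqrt s\<close>. The usual
second-order error of a step, \<open>\<parallel>v k\<parallel>\<^sup>2 / s (Suc k)\<close>, adds up to about the logarithm of \<open>s\<close>, which may diverge, but
after the division it is dominated by a telescoping quantity. The correlation between \<open>v k\<close> and the step size
\<open>1 / sqrt (s (Suc k))\<close> is absorbed by Young's inequality with a weight known before the step. This gives
a Lyapunov function whose expected decrease is at least a multiple of the expectation of \<open>\<parallel>\<nabla>g(x k)\<parallel>\<^sup>2 / s k\<close>; hence these terms have a finite
expected sum. By the second moment condition, \<open>\<parallel>v k\<parallel>\<^sup>2 / s k\<close> is then summable over the times at which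
\<open>\<parallel>\<nabla>g(x k)\<parallel>\<^sup>2 > \<nu>\<close>, for every \<open>\<nu> > 0\<close>, and over these times the martingale series of the noise
\<open>(v k - \<nabla>g(x k)) / sqrt (s k)\<close> converges (\<open>martingale_differences.AE_summable\<close>, proved from a maximal inequality).

Deterministic part. If \<open>s\<close> is bounded, the summability of \<open>\<parallel>\<nabla>g(x k)\<parallel>\<^sup>2 / s k\<close> is already the claim. Otherwise
\<open>s\<close> diverges. The trajectory cannot stay forever in the region \<open>\<parallel>\<nabla>g\<parallel>\<^sup>2 > \<nu>\<close>, because there \<open>s\<close> has summable relative
increments (\<open>frequently_near_critical\<close>). During any late excursion into this region the noise is
negligible, so up to a vanishing error \<open>h = sqrt (1 + g)\<close> decreases, and as long as it is bounded it decreases at least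
in proportion to the distance covered (\<open>excursion_descent\<close>, \<open>excursion_displacement\<close>). The root makes the gradient of the observed
function bounded, so the noise is under control before the trajectory is known to be bounded. Moreover the steps tend to
zero (\<open>step_tendsto_0\<close>; here the stochastic gradients must be bounded where the gradient is small), so
\<open>h\<close> cannot cross upwards infinitely often any band of values without critical points (\<open>no_upcrossing\<close>).
The gradient is bounded below at infinity, so high bands are of this kind and \<open>h\<close> stays bounded; the critical values
are nowhere dense, so every interval contains such a band and \<open>h\<close> converges (\<open>convergent_root_g\<close>). Finally, if the
gradient did not tend to zero, infinitely many excursions would lead from small to large gradients; by
the Lipschitz condition each covers at least a fixed distance and therefore costs \<open>h\<close> a fixed amount, which contradicts
convergence (\<open>gradient_tendsto_0_if_convergent\<close>).\<close>

section \<open>Smooth nonnegative objectives\<close>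

locale smooth_objective =
  fixes g :: "'a::euclidean_space \<Rightarrow> real" and gradg :: "'a \<Rightarrow> 'a" and L :: real
  assumes gradient: "GDERIV g x :> gradg x"
    and g_nonneg: "0 \<le> g x"
    and L_pos: "L > 0"
    and gradient_lipschitz: "norm (gradg x - gradg y) \<le> L * norm (x - y)"
begin

lemma continuous_g: "continuous_on UNIV g"
  using gradient has_derivative_continuous unfolding gderiv_def
  by (blast intro: continuous_at_imp_continuous_on)

lemma continuous_gradg: "continuous_on UNIV gradg"
proof (rule continuous_at_imp_continuous_on, rule ballI)
  have "L-lipschitz_on UNIV gradg"
    using gradient_lipschitz L_pos by (auto simp: lipschitz_on_def dist_norm)
  then show "isCont gradg x" for x
    by (rule lipschitz_on_continuous_within) simp
qed

lemma borel_measurable_g [measurable]: "g \<in> borel_measurable borel"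
  using continuous_g by (rule borel_measurable_continuous_onI)

lemma borel_measurable_gradg [measurable]: "gradg \<in> borel_measurable borel"
  using continuous_gradg by (rule borel_measurable_continuous_onI)

text \<open>Compare the derivatives of both sides along the segment from \<open>x\<close> to \<open>x + d\<close>.\<close>

lemma descent_lemma: "g (x + d) \<le> g x + gradg x \<bullet> d + L / 2 * (norm d)\<^sup>2"
proof -
  define \<phi> where "\<phi> t = g (x + t *\<^sub>R d) - t * (gradg x \<bullet> d) - L / 2 * (norm d)\<^sup>2 * t\<^sup>2" for t :: real
  define \<phi>' where "\<phi>' t = gradg (x + t *\<^sub>R d) \<bullet> d - gradg x \<bullet> d - L * (norm d)\<^sup>2 * t" for t :: real
  have path: "((\<lambda>t. g (x + t *\<^sub>R d)) has_real_derivative gradg (x + t *\<^sub>R d) \<bullet> d) (at t)" for t :: real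
  proof -
    have "((\<lambda>t. x + t *\<^sub>R d) has_derivative (\<lambda>h. h *\<^sub>R d)) (at t)"
      by (auto intro!: derivative_eq_intros)
    moreover have "(g has_derivative (\<lambda>h. h \<bullet> gradg (x + t *\<^sub>R d))) (at (x + t *\<^sub>R d))"
      using gradient by (simp add: gderiv_def)
    ultimately have "(g \<circ> (\<lambda>t. x + t *\<^sub>R d) has_derivative
        (\<lambda>h. h \<bullet> gradg (x + t *\<^sub>R d)) \<circ> (\<lambda>h. h *\<^sub>R d)) (at t)"
      by (rule diff_chain_at)
    then show ?thesis
      by (simp add: o_def has_field_derivative_def inner_commute mult_commute_abs)
  qed
  have der: "(\<phi> has_real_derivative \<phi>' t) (at t)" for t
    unfolding \<phi>_def \<phi>'_def by (rule derivative_eq_intros path refl | simp)+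
  have "\<phi>' t \<le> 0" if "0 \<le> t" for t
  proof -
    have "(gradg (x + t *\<^sub>R d) - gradg x) \<bullet> d \<le> norm (gradg (x + t *\<^sub>R d) - gradg x) * norm d"
      by (rule norm_cauchy_schwarz)
    also have "\<dots> \<le> (L * norm (t *\<^sub>R d)) * norm d"
      using gradient_lipschitz[of "x + t *\<^sub>R d" x] by (intro mult_right_mono) auto
    finally show ?thesis
      using that by (simp add: \<phi>'_def inner_diff_left power2_eq_square algebra_simps)
  qed
  then have "\<phi> 1 \<le> \<phi> 0"
    using der by (intro DERIV_nonpos_imp_nonincreasing[of 0 1 \<phi>]) auto
  then show ?thesis
    by (simp add: \<phi>_def algebra_simps)
qed

text \<open>A gradient step of length \<open>1 / L\<close> lowers the value by at least \<open>\<parallel>\<nabla>g\<parallel>\<^sup>2 / (2 L)\<close>, and the result is still nonnegative.\<close>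

lemma gradient_le_value: "(norm (gradg x))\<^sup>2 \<le> 2 * L * g x"
proof -
  have "0 \<le> g (x + (- (1 / L)) *\<^sub>R gradg x)"
    by (rule g_nonneg)
  also have "\<dots> \<le> g x + gradg x \<bullet> ((- (1 / L)) *\<^sub>R gradg x) + L / 2 * (norm ((- (1 / L)) *\<^sub>R gradg x))\<^sup>2"
    by (rule descent_lemma)
  also have "\<dots> = g x - (norm (gradg x))\<^sup>2 / L + L / 2 * ((norm (gradg x))\<^sup>2 / L\<^sup>2)"
    using L_pos by (simp add: power2_norm_eq_inner power_divide)
  also have "\<dots> = g x - (norm (gradg x))\<^sup>2 / (2 * L)"
    using L_pos by (simp add: power2_eq_square divide_simps)
  finally show ?thesis
    using L_pos by (simp add: field_simps)
qed

text \<open>The observable for the whole convergence argument. Its gradient \<open>\<nabla>g / (2 root_g)\<close> is bounded on the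
whole space while it still satisfies a descent lemma, so the fluctuations of its noise are controlled without
knowing that the trajectory is bounded.\<close>

definition root_g :: "'a \<Rightarrow> real" where
  "root_g x = sqrt (1 + g x)"

lemma root_g_ge_1: "1 \<le> root_g x"
  using g_nonneg[of x] by (simp add: root_g_def)

lemma root_g_pos: "0 < root_g x"
  using root_g_ge_1[of x] by linarith

lemma root_g_squared: "(root_g x)\<^sup>2 = 1 + g x"
  using g_nonneg[of x] by (simp add: root_g_def)

lemma borel_measurable_root_g [measurable]: "root_g \<in> borel_measurable borel"
  unfolding root_g_def[abs_def] by measurable

lemma continuous_root_g: "continuous_on UNIV root_g"
  unfolding root_g_def[abs_def] by (intro continuous_intros continuous_g)

lemma gradient_over_root_g: "norm (gradg x) / root_g x \<le> sqrt (2 * L)"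
proof -
  have "(norm (gradg x))\<^sup>2 \<le> (sqrt (2 * L) * root_g x)\<^sup>2"
    using gradient_le_value[of x] L_pos
    by (simp only: power_mult_distrib root_g_squared) (simp add: distrib_left)
  then have "norm (gradg x) \<le> sqrt (2 * L) * root_g x"
    using L_pos root_g_pos[of x] by (auto dest: power2_le_imp_le)
  then show ?thesis
    using root_g_pos[of x] by (simp add: pos_divide_le_eq)
qed

text \<open>Concavity of the square root, in the form \<open>2 r r' \<le> r\<^sup>2 + r'\<^sup>2\<close>, transfers the descent lemma from \<open>g\<close>.\<close>

lemma root_g_descent:
  "root_g (x + d) \<le> root_g x + gradg x \<bullet> d / (2 * root_g x) + L / 4 * (norm d)\<^sup>2"
proof -
  let ?r = "root_g x" and ?r' = "root_g (x + d)"
  have "2 * ?r * ?r' \<le> ?r\<^sup>2 + ?r'\<^sup>2"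
    by (rule sum_squares_bound)
  also have "\<dots> \<le> 2 * ?r\<^sup>2 + gradg x \<bullet> d + L / 2 * (norm d)\<^sup>2"
    using descent_lemma[of x d] by (simp add: root_g_squared)
  finally have "?r' \<le> (2 * ?r\<^sup>2 + gradg x \<bullet> d + L / 2 * (norm d)\<^sup>2) / (2 * ?r)"
    using root_g_pos[of x] by (simp add: pos_le_divide_eq mult_ac)
  also have "\<dots> = ?r + gradg x \<bullet> d / (2 * ?r) + L / 4 * (norm d)\<^sup>2 / ?r"
    using root_g_pos[of x] by (simp add: add_divide_distrib power2_eq_square)
  also have "L / 4 * (norm d)\<^sup>2 / ?r \<le> L / 4 * (norm d)\<^sup>2 / 1"
    using root_g_ge_1[of x] L_pos by (intro divide_left_mono) auto
  finally show ?thesis by simp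
qed

definition steep :: "real \<Rightarrow> 'a set" where
  "steep \<nu> = {y. \<nu> < (norm (gradg y))\<^sup>2}"

lemma steep_borel [measurable]: "steep \<nu> \<in> sets borel"
  unfolding steep_def by measurable


lemma root_g_bounded_near_critical:
  assumes "Liminf at_infinity (\<lambda>y. ereal ((norm (gradg y))\<^sup>2)) > ereal \<eta>"
  obtains K where "\<And>y. y \<notin> steep \<eta> \<Longrightarrow> root_g y \<le> K"
proof -
  have "\<forall>\<^sub>F y in at_infinity. ereal \<eta> < ereal ((norm (gradg y))\<^sup>2)"
    using assms by (rule less_LiminfD)
  then obtain b where b: "\<And>y. b \<le> norm y \<Longrightarrow> y \<in> steep \<eta>"
    by (auto simp: eventually_at_infinity steep_def)
  have "compact (root_g ` cball 0 b)"
    by (intro compact_continuous_image continuous_on_subset[OF continuous_root_g]) auto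
  then obtain K where K: "\<forall>r\<in>root_g ` cball 0 b. norm r \<le> K"
    using compact_imp_bounded bounded_iff by metis
  show thesis
  proof (rule that)
    fix y assume "y \<notin> steep \<eta>"
    then have "y \<in> cball 0 b" using b[of y] by force
    with K have "norm (root_g y) \<le> K" by blast
    then show "root_g y \<le> K" by simp
  qed
qed

lemma compact_level_band:
  assumes "filterlim g at_top at_infinity"
  shows "compact {y. p \<le> root_g y \<and> root_g y \<le> q}"
proof -
  have "closed {y. p \<le> root_g y \<and> root_g y \<le> q}"
    by (intro closed_Collect_conj closed_Collect_le continuous_on_const continuous_root_g)
  moreover have "\<forall>\<^sub>F y in at_infinity. q\<^sup>2 \<le> g y"
    using assms by (simp add: filterlim_at_top)
  then obtain b where b: "\<And>y. b \<le> norm y \<Longrightarrow> q\<^sup>2 \<le> g y"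
    by (auto simp: eventually_at_infinity)
  have "{y. p \<le> root_g y \<and> root_g y \<le> q} \<subseteq> cball 0 b"
  proof
    fix y assume "y \<in> {y. p \<le> root_g y \<and> root_g y \<le> q}"
    then have "(root_g y)\<^sup>2 \<le> q\<^sup>2"
      using root_g_pos[of y] by (intro power_mono) auto
    then have "g y < q\<^sup>2" by (simp add: root_g_squared)
    then show "y \<in> cball 0 b" using b[of y] by force
  qed
  then have "bounded {y. p \<le> root_g y \<and> root_g y \<le> q}"
    using bounded_cball bounded_subset by blast
  ultimately show ?thesis by (simp add: compact_eq_bounded_closed)
qed

text \<open>The closed set of critical values leaves out a small interval of values of \<open>g\<close>; the corresponding band is
compact by coercivity, so the gradient is bounded away from zero on it.\<close>

lemma noncritical_band:
  assumes coercive: "filterlim g at_top at_infinity"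
    and critical: "nowhere_dense {g y | y. gradg y = 0}"
    and pq: "0 \<le> p" "p < q"
  shows "\<exists>p' q' \<nu>. p \<le> p' \<and> p' < q' \<and> q' \<le> q \<and> \<nu> > 0 \<and>
    (\<forall>y. p' \<le> root_g y \<longrightarrow> root_g y \<le> q' \<longrightarrow> y \<in> steep \<nu>)"
proof -
  \<comment> \<open>Values of \<open>root_g\<close> between \<open>p\<close> and \<open>q\<close> are values of \<open>g\<close> between \<open>p\<^sup>2 - 1\<close> and \<open>q\<^sup>2 - 1\<close>.\<close>
  let ?Z = "closure {g y | y. gradg y = 0}"
  have "p\<^sup>2 < q\<^sup>2" using pq by (intro power_strict_mono) auto
  have "\<not> {p\<^sup>2 - 1<..<q\<^sup>2 - 1} \<subseteq> ?Z"
  proof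
    assume "{p\<^sup>2 - 1<..<q\<^sup>2 - 1} \<subseteq> ?Z"
    then have "{p\<^sup>2 - 1<..<q\<^sup>2 - 1} \<subseteq> interior ?Z" by (intro interior_maximal) auto
    then have "{p\<^sup>2 - 1<..<q\<^sup>2 - 1} = {}" using critical by (simp add: nowhere_dense_def)
    with \<open>p\<^sup>2 < q\<^sup>2\<close> show False by (simp add: greaterThanLessThan_empty_iff2)
  qed
  then obtain z where "z \<in> {p\<^sup>2 - 1<..<q\<^sup>2 - 1}" "z \<notin> ?Z" by blast
  then have z: "p\<^sup>2 - 1 < z" "z < q\<^sup>2 - 1" "z \<notin> ?Z" by auto
  have "open ({p\<^sup>2 - 1<..<q\<^sup>2 - 1} - ?Z)" "z \<in> {p\<^sup>2 - 1<..<q\<^sup>2 - 1} - ?Z"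
    using z by auto
  then obtain e where e: "e > 0" "cball z e \<subseteq> {p\<^sup>2 - 1<..<q\<^sup>2 - 1} - ?Z"
    unfolding open_contains_cball by blast
  define p' where "p' = sqrt (1 + z)"
  define q' where "q' = sqrt (1 + (z + e))"
  have "0 \<le> 1 + z" using z(1) zero_le_power2[of p] by linarith
  have "z + e \<in> cball z e" using e(1) by (simp add: dist_real_def)
  then have "z + e < q\<^sup>2 - 1" using e(2) by auto
  have p'q': "p \<le> p'" "p' < q'" "q' \<le> q"
  proof -
    show "p \<le> p'" unfolding p'_def using z(1) by (intro real_le_rsqrt) simp
    show "p' < q'" unfolding p'_def q'_def using e(1) by simp
    show "q' \<le> q" unfolding q'_def using \<open>z + e < q\<^sup>2 - 1\<close> pq by (intro real_le_lsqrt) auto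
  qed
  let ?K = "{y. p' \<le> root_g y \<and> root_g y \<le> q'}"
  have noncritical: "gradg y \<noteq> 0" if "y \<in> ?K" for y
  proof
    assume "gradg y = 0"
    then have "g y \<in> {g y | y. gradg y = 0}" by blast
    then have "g y \<in> ?Z" by (rule subsetD[OF closure_subset])
    moreover have "z \<le> g y" "g y \<le> z + e"
      using that by (simp_all add: p'_def q'_def root_g_def)
    then have "g y \<in> cball z e" by (simp add: dist_real_def abs_le_iff)
    ultimately show False using e(2) by blast
  qed
  have "\<exists>\<nu>>0. \<forall>y\<in>?K. \<nu> < (norm (gradg y))\<^sup>2"
  proof (cases "?K = {}")
    case True
    then show ?thesis by (intro exI[of _ 1]) auto
  next
    case False
    have "continuous_on ?K (\<lambda>y. (norm (gradg y))\<^sup>2)"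
      by (intro continuous_intros continuous_on_subset[OF continuous_gradg]) auto
    then obtain y0 where y0: "y0 \<in> ?K" "\<And>y. y \<in> ?K \<Longrightarrow> (norm (gradg y0))\<^sup>2 \<le> (norm (gradg y))\<^sup>2"
      using continuous_attains_inf[OF compact_level_band[OF coercive] False] by blast
    have "0 < (norm (gradg y0))\<^sup>2" using noncritical[OF y0(1)] by simp
    then have "(norm (gradg y0))\<^sup>2 / 2 < (norm (gradg y))\<^sup>2" if "y \<in> ?K" for y
      using y0(2)[OF that] by linarith
    then show ?thesis
      using \<open>0 < (norm (gradg y0))\<^sup>2\<close> half_gt_zero by blast
  qed
  then show ?thesis using p'q' by (auto simp: steep_def)
qed

end


section \<open>One step along a trajectory\<close>

text \<open>Estimates for replacing the step size after the update of \<open>s\<close> by the one before it. The fourth says that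
\<open>u\<^sup>2 / (sqrt s (s + u\<^sup>2))\<close> telescopes, unlike \<open>u\<^sup>2 / (s + u\<^sup>2)\<close>.\<close>

lemma inverse_sqrt_gap:
  fixes s u :: real
  assumes "0 < s" "0 \<le> u"
  shows "0 \<le> 1 / sqrt s - 1 / sqrt (s + u\<^sup>2)"
    and "(1 / sqrt s - 1 / sqrt (s + u\<^sup>2)) * u \<le> u\<^sup>2 / (sqrt s * sqrt (s + u\<^sup>2))"
    and "u\<^sup>2 / (sqrt s * sqrt (s + u\<^sup>2)) \<le> u\<^sup>2 / s"
    and "u\<^sup>2 / (sqrt s * (s + u\<^sup>2)) \<le> 2 * (1 / sqrt s - 1 / sqrt (s + u\<^sup>2))"
    and "u / sqrt (s + u\<^sup>2) \<le> 1"
proof -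
  define p where "p = sqrt s"
  define q where "q = sqrt (s + u\<^sup>2)"
  have p: "0 < p" "p\<^sup>2 = s" using assms by (auto simp: p_def)
  have q: "p \<le> q" "u \<le> q" "q\<^sup>2 = s + u\<^sup>2" using assms by (auto simp: p_def q_def real_le_rsqrt)
  have qp: "q - p \<le> u"
    using sqrt_add_le_add_sqrt[of s "u\<^sup>2"] assms by (simp add: p_def q_def)
  have gap: "1 / p - 1 / q = (q - p) / (p * q)"
    using p q by (simp add: field_simps)
  show "0 \<le> 1 / sqrt s - 1 / sqrt (s + u\<^sup>2)"
    unfolding p_def[symmetric] q_def[symmetric] gap using p q by simp
  show "(1 / sqrt s - 1 / sqrt (s + u\<^sup>2)) * u \<le> u\<^sup>2 / (sqrt s * sqrt (s + u\<^sup>2))"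
    unfolding p_def[symmetric] q_def[symmetric] gap using p q qp assms
    by (simp add: divide_right_mono mult_right_mono power2_eq_square)
  show "u\<^sup>2 / (sqrt s * sqrt (s + u\<^sup>2)) \<le> u\<^sup>2 / s"
    unfolding p_def[symmetric] q_def[symmetric] using p q
    by (intro divide_left_mono) (auto simp: power2_eq_square mult_left_mono simp flip: p(2))
  have "u\<^sup>2 = (q - p) * (q + p)" using p q by (simp add: algebra_simps power2_eq_square)
  also have "\<dots> \<le> (q - p) * (2 * q)" using q by (intro mult_left_mono) auto
  finally have "u\<^sup>2 / (p * q\<^sup>2) \<le> ((q - p) * (2 * q)) / (p * q\<^sup>2)"
    using p q by (intro divide_right_mono) auto
  also have "\<dots> = 2 * (1 / p - 1 / q)"
    unfolding gap using p(1) q(1) by (simp add: power2_eq_square divide_simps)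
  finally show "u\<^sup>2 / (sqrt s * (s + u\<^sup>2)) \<le> 2 * (1 / sqrt s - 1 / sqrt (s + u\<^sup>2))"
    unfolding p_def[symmetric] q_def[symmetric] using q(3) by simp
  show "u / sqrt (s + u\<^sup>2) \<le> 1"
    unfolding q_def[symmetric] using p q by simp
qed

text \<open>A single trajectory, indexed from 0 so that \<open>s k\<close> and \<open>x k\<close> are both known before \<open>v k\<close> is drawn.\<close>

locale adagrad_path = smooth_objective g gradg L
  for g :: "'a::euclidean_space \<Rightarrow> real" and gradg :: "'a \<Rightarrow> 'a" and L :: real +
  fixes x v :: "nat \<Rightarrow> 'a" and s :: "nat \<Rightarrow> real" and \<alpha> :: real
  assumes alpha_pos: "\<alpha> > 0"
    and s0_pos: "s 0 > 0"
    and s_Suc: "s (Suc k) = s k + (norm (v k))\<^sup>2"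
    and x_Suc: "x (Suc k) = x k - (\<alpha> / sqrt (s (Suc k))) *\<^sub>R v k"
begin

lemma s_pos: "0 < s k"
  by (induction k) (auto simp: s0_pos s_Suc intro: add_pos_nonneg)

lemma incseq_s: "incseq s"
  by (intro incseq_SucI) (simp add: s_Suc)

lemma step_length: "norm (x (Suc k) - x k) = \<alpha> * (norm (v k) / sqrt (s (Suc k)))"
  using alpha_pos s_pos[of "Suc k"] by (simp add: x_Suc)

lemma relative_step_le_1: "norm (v k) / sqrt (s (Suc k)) \<le> 1"
  using inverse_sqrt_gap(5)[of "s k" "norm (v k)"] s_pos by (simp add: s_Suc)

text \<open>The second-order term and the effect of the step size depending on \<open>v k\<close> are both of order \<open>\<parallel>v k\<parallel>\<^sup>2 / s k\<close>.
What remains is a decrease and a noise term that is linear in \<open>v k - \<nabla>g(x k)\<close>.\<close>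

lemma root_g_step:
  "root_g (x (Suc k)) \<le> root_g (x k)
     - \<alpha> / 2 * ((norm (gradg (x k)))\<^sup>2 / (sqrt (s k) * root_g (x k)))
     - \<alpha> / 2 * (gradg (x k) \<bullet> (v k - gradg (x k)) / root_g (x k) / sqrt (s k))
     + (\<alpha> / 2 * sqrt (2 * L) + L / 4 * \<alpha>\<^sup>2) * ((norm (v k))\<^sup>2 / s k)"
proof -
  define r where "r = root_g (x k)"
  define p where "p = sqrt (s k)"
  define q where "q = sqrt (s (Suc k))"
  define u where "u = norm (v k)"
  define G where "G = gradg (x k)"
  note gap = inverse_sqrt_gap[of "s k" u, OF s_pos, unfolded u_def, OF norm_ge_zero,
      folded s_Suc p_def q_def u_def]
  have r: "0 < r" unfolding r_def by (rule root_g_pos)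
  have p: "0 < p" and q: "0 < q" by (auto simp: p_def q_def s_pos)
  have "root_g (x (Suc k)) = root_g (x k + (- (\<alpha> / q)) *\<^sub>R v k)"
    by (simp add: x_Suc q_def)
  also have "\<dots> \<le> r + G \<bullet> ((- (\<alpha> / q)) *\<^sub>R v k) / (2 * r) + L / 4 * (norm ((- (\<alpha> / q)) *\<^sub>R v k))\<^sup>2"
    unfolding r_def G_def by (rule root_g_descent)
  also have "\<dots> = r - \<alpha> / 2 * (G \<bullet> v k / r / p) + \<alpha> / (2 * r) * ((1 / p - 1 / q) * (G \<bullet> v k))
      + L / 4 * \<alpha>\<^sup>2 * (u / q)\<^sup>2"
    using r p q by (simp add: u_def power_mult_distrib power_divide algebra_simps diff_divide_distrib)
  also have "(u / q)\<^sup>2 \<le> u\<^sup>2 / s k"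
    using s_pos[of k] s_pos[of "Suc k"] monoD[OF incseq_s, of k "Suc k"]
    by (auto simp: q_def power_divide intro!: divide_left_mono mult_pos_pos)
  also have "\<alpha> / (2 * r) * ((1 / p - 1 / q) * (G \<bullet> v k)) \<le> \<alpha> / 2 * sqrt (2 * L) * (u\<^sup>2 / s k)"
  proof -
    have "(1 / p - 1 / q) * (G \<bullet> v k) \<le> (1 / p - 1 / q) * (norm G * u)"
      unfolding u_def using gap(1) by (intro mult_left_mono norm_cauchy_schwarz)
    also have "\<dots> = norm G * ((1 / p - 1 / q) * u)" by simp
    also have "\<dots> \<le> norm G * (u\<^sup>2 / s k)"
      using gap(2,3) by (intro mult_left_mono) auto
    finally have "\<alpha> / (2 * r) * ((1 / p - 1 / q) * (G \<bullet> v k)) \<le> \<alpha> / (2 * r) * (norm G * (u\<^sup>2 / s k))"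
      using alpha_pos r by (intro mult_left_mono) auto
    also have "\<dots> = \<alpha> / 2 * (norm G / r) * (u\<^sup>2 / s k)" by simp
    also have "\<dots> \<le> \<alpha> / 2 * sqrt (2 * L) * (u\<^sup>2 / s k)"
      unfolding G_def r_def using alpha_pos s_pos[of k] gradient_over_root_g[of "x k"]
      by (intro mult_right_mono mult_left_mono) auto
    finally show ?thesis .
  qed
  also have "G \<bullet> v k / r / p = (norm G)\<^sup>2 / (p * r) + G \<bullet> (v k - G) / r / p"
    by (simp add: inner_diff_right power2_norm_eq_inner diff_divide_distrib mult.commute)
  finally show ?thesis
    unfolding G_def[symmetric] r_def[symmetric] p_def[symmetric] u_def[symmetric]
    using L_pos alpha_pos by (simp add: algebra_simps add_divide_distrib diff_divide_distrib)
qed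

text \<open>The step size contains \<open>s (Suc k)\<close> instead of \<open>s k\<close>; the correction is of order \<open>\<parallel>v k\<parallel>\<^sup>2 / s k\<close>.\<close>

lemma displacement_step:
  "norm (x (Suc k) - x k + (\<alpha> / sqrt (s k)) *\<^sub>R (v k - gradg (x k)))
     \<le> \<alpha> * (norm (gradg (x k)) / sqrt (s k)) + \<alpha> * ((norm (v k))\<^sup>2 / s k)"
proof -
  let ?p = "sqrt (s k)" and ?q = "sqrt (s (Suc k))"
  note gap = inverse_sqrt_gap[of "s k" "norm (v k)", OF s_pos norm_ge_zero, folded s_Suc]
  have "x (Suc k) - x k + (\<alpha> / ?p) *\<^sub>R (v k - gradg (x k))
      = (\<alpha> * (1 / ?p - 1 / ?q)) *\<^sub>R v k - (\<alpha> / ?p) *\<^sub>R gradg (x k)"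
    by (simp add: x_Suc algebra_simps)
  also have "norm \<dots> \<le> norm ((\<alpha> * (1 / ?p - 1 / ?q)) *\<^sub>R v k) + norm ((\<alpha> / ?p) *\<^sub>R gradg (x k))"
    by (rule norm_triangle_ineq4)
  also have "\<dots> = \<alpha> * ((1 / ?p - 1 / ?q) * norm (v k)) + \<alpha> * (norm (gradg (x k)) / ?p)"
    using gap(1) alpha_pos s_pos[of k] by (simp add: abs_mult)
  also have "\<dots> \<le> \<alpha> * ((norm (v k))\<^sup>2 / s k) + \<alpha> * (norm (gradg (x k)) / ?p)"
    using gap(2,3) alpha_pos by (intro add_right_mono mult_left_mono) auto
  finally show ?thesis by simp
qed

text \<open>The main term is \<open>g / sqrt s\<close>. The second one absorbs the part of the second moment bound that is proportional to
\<open>\<parallel>\<nabla>g\<parallel>\<^sup>2\<close>; the last two are the potentials of the telescoping errors \<open>1 / s k - 1 / s (Suc k)\<close> and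
\<open>1 / sqrt (s k) - 1 / sqrt (s (Suc k))\<close>.\<close>

definition lyapunov :: "real \<Rightarrow> real \<Rightarrow> 'a \<Rightarrow> real \<Rightarrow> real" where
  "lyapunov \<sigma>0 \<sigma>1 y t = g y / sqrt t + \<alpha> * \<sigma>0 * ((norm (gradg y))\<^sup>2 / t)
     + \<alpha> * (\<sigma>1 + 1 + \<sigma>0 * L\<^sup>2 * \<alpha>\<^sup>2 * (4 * (\<sigma>0 + 1) + 1)) / t + L * \<alpha>\<^sup>2 / sqrt t"

text \<open>The factor \<open>\<sigma>0 \<parallel>\<nabla>g\<parallel>\<^sup>2 + \<sigma>1 + 1\<close> in a denominator dominates the conditional second moment of \<open>v k\<close>. In expectation
each of the two positive terms is therefore at most a quarter of the decrease produced by the inner product.\<close>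

lemma lyapunov_step:
  assumes \<sigma>: "0 \<le> \<sigma>0" "0 \<le> \<sigma>1"
  shows "lyapunov \<sigma>0 \<sigma>1 (x (Suc k)) (s (Suc k)) \<le> lyapunov \<sigma>0 \<sigma>1 (x k) (s k)
     - \<alpha> * (gradg (x k) \<bullet> v k / s k)
     + \<alpha> / 4 * ((norm (gradg (x k)))\<^sup>2 / ((\<sigma>0 * (norm (gradg (x k)))\<^sup>2 + \<sigma>1 + 1) * s k) * (norm (v k))\<^sup>2)
     + \<alpha> / 4 * ((norm (gradg (x k)))\<^sup>2 / s k)"
proof -
  define p where "p = sqrt (s k)"
  define q where "q = sqrt (s (Suc k))"
  define u where "u = norm (v k)"
  define a where "a = norm (gradg (x k))"
  define a' where "a' = norm (gradg (x (Suc k)))"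
  define G where "G = gradg (x k)"
  define Q where "Q = \<sigma>0 * a\<^sup>2 + \<sigma>1 + 1"
  note gap = inverse_sqrt_gap[of "s k" u, OF s_pos, unfolded u_def, OF norm_ge_zero,
      folded s_Suc p_def q_def u_def]
  have p: "0 < p" "s k = p\<^sup>2" and q: "0 < q" "s (Suc k) = q\<^sup>2" and pq: "p \<le> q"
    using s_pos[of k] s_pos[of "Suc k"] monoD[OF incseq_s, of k "Suc k"] by (auto simp: p_def q_def)
  have u: "u\<^sup>2 = q\<^sup>2 - p\<^sup>2" "0 \<le> u"
    using s_Suc[of k] by (simp_all add: p q u_def)
  have a: "0 \<le> a" "0 \<le> a'" by (simp_all add: a_def a'_def)
  have Q: "0 < Q" using \<sigma> by (simp add: Q_def add_nonneg_pos)
  have gap2: "u\<^sup>2 / (p\<^sup>2 * q\<^sup>2) = 1 / p\<^sup>2 - 1 / q\<^sup>2"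
    using p(1) q(1) by (simp add: u diff_divide_distrib)
  have value_step: "g (x (Suc k)) / q \<le> g (x k) / p - \<alpha> * (G \<bullet> v k / p\<^sup>2) + \<alpha> * (a * (u\<^sup>2 / (p\<^sup>2 * q)))
      + L * \<alpha>\<^sup>2 * (1 / p - 1 / q)"
  proof -
    have "g (x (Suc k)) / q \<le> g (x (Suc k)) / p"
      using p q pq g_nonneg by (intro divide_left_mono) auto
    also have "g (x (Suc k)) / p
        \<le> (g (x k) + G \<bullet> ((- (\<alpha> / q)) *\<^sub>R v k) + L / 2 * (norm ((- (\<alpha> / q)) *\<^sub>R v k))\<^sup>2) / p"
      using descent_lemma[of "x k" "(- (\<alpha> / q)) *\<^sub>R v k"] p
      by (intro divide_right_mono) (auto simp: x_Suc q_def G_def)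
    also have "\<dots> = g (x k) / p - \<alpha> * (G \<bullet> v k / p\<^sup>2) + \<alpha> / p * ((1 / p - 1 / q) * (G \<bullet> v k))
        + L / 2 * \<alpha>\<^sup>2 * (u\<^sup>2 / (p * q\<^sup>2))"
      using p(1) q(1) by (simp add: u_def power_mult_distrib power_divide field_simps power2_eq_square)
    also have "(1 / p - 1 / q) * (G \<bullet> v k) \<le> a * (u\<^sup>2 / (p * q))"
    proof -
      have "(1 / p - 1 / q) * (G \<bullet> v k) \<le> (1 / p - 1 / q) * (a * u)"
        unfolding u_def a_def G_def using gap(1) by (intro mult_left_mono norm_cauchy_schwarz)
      also have "\<dots> = a * ((1 / p - 1 / q) * u)" by simp
      also have "\<dots> \<le> a * (u\<^sup>2 / (p * q))"
        using gap(2) a by (intro mult_left_mono) auto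
      finally show ?thesis .
    qed
    also have "u\<^sup>2 / (p * q\<^sup>2) \<le> 2 * (1 / p - 1 / q)"
      using gap(4) by (simp add: q)
    finally show ?thesis
      using L_pos alpha_pos p(1)
      by (simp add: power2_eq_square mult_left_mono divide_right_mono right_diff_distrib diff_divide_distrib mult.assoc)
  qed
  \<comment> \<open>Young's inequality; the weight \<open>Q\<close> depends only on the state before the step, so the first term keeps its
      conditional expectation under control and the second one telescopes.\<close>
  have young: "a * (u\<^sup>2 / (p\<^sup>2 * q)) \<le> 1 / 4 * (a\<^sup>2 / (Q * p\<^sup>2) * u\<^sup>2) + Q * (1 / p\<^sup>2 - 1 / q\<^sup>2)"
  proof -
    have "0 \<le> (a / (2 * Q) - 1 / q)\<^sup>2" by simp
    then have "a / (Q * q) \<le> a\<^sup>2 / (4 * Q\<^sup>2) + 1 / q\<^sup>2"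
      using Q q by (simp add: power2_diff power_divide power_mult_distrib)
    then have "(Q * u\<^sup>2 / p\<^sup>2) * (a / (Q * q)) \<le> (Q * u\<^sup>2 / p\<^sup>2) * (a\<^sup>2 / (4 * Q\<^sup>2) + 1 / q\<^sup>2)"
      using Q by (intro mult_left_mono) auto
    also have "\<dots> = 1 / 4 * (a\<^sup>2 / (Q * p\<^sup>2) * u\<^sup>2) + Q * (u\<^sup>2 / (p\<^sup>2 * q\<^sup>2))"
      using Q p(1) q(1) by (simp add: field_simps power2_eq_square)
    finally show ?thesis
      using Q by (simp add: gap2 mult_ac)
  qed
  \<comment> \<open>The Young parameter is chosen such that \<open>\<sigma>0 \<kappa> \<le> 1 / 4\<close>: the change of the gradient then costs at most a quarter of the decrease.\<close>
  define \<kappa> where "\<kappa> = 1 / (4 * (\<sigma>0 + 1))"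
  have \<kappa>: "0 < \<kappa>" "\<sigma>0 * \<kappa> \<le> 1 / 4" "1 / \<kappa> = 4 * (\<sigma>0 + 1)"
    using \<sigma> by (auto simp: \<kappa>_def field_simps)
  have gradient_change: "a'\<^sup>2 / q\<^sup>2 \<le> a\<^sup>2 / q\<^sup>2 + \<kappa> * (a\<^sup>2 / p\<^sup>2)
      + L\<^sup>2 * \<alpha>\<^sup>2 * (1 / \<kappa> + 1) * (1 / p\<^sup>2 - 1 / q\<^sup>2)"
  proof -
    define b where "b = L * (\<alpha> * (u / q))"
    have "a' \<le> a + b"
      using gradient_lipschitz[of "x (Suc k)" "x k"] norm_triangle_sub[of "gradg (x (Suc k))" "gradg (x k)"]
      unfolding step_length by (simp add: a_def a'_def b_def u_def q_def)
    then have "a'\<^sup>2 \<le> (a + b)\<^sup>2" using a by (intro power_mono) auto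
    also have "\<dots> = a\<^sup>2 + 2 * a * b + b\<^sup>2" by (simp add: power2_sum)
    also have "2 * a * b \<le> \<kappa> * a\<^sup>2 + b\<^sup>2 / \<kappa>"
    proof -
      have "0 \<le> (\<kappa> * a - b)\<^sup>2 / \<kappa>" using \<kappa> by simp
      also have "\<dots> = \<kappa> * a\<^sup>2 + b\<^sup>2 / \<kappa> - 2 * a * b"
        using \<kappa>(1) by (simp add: power2_eq_square field_simps)
      finally show ?thesis by simp
    qed
    finally have "a'\<^sup>2 / q\<^sup>2 \<le> (a\<^sup>2 + (\<kappa> * a\<^sup>2 + b\<^sup>2 / \<kappa>) + b\<^sup>2) / q\<^sup>2"
      by (intro divide_right_mono) auto
    also have "\<dots> = a\<^sup>2 / q\<^sup>2 + \<kappa> * (a\<^sup>2 / q\<^sup>2) + (1 / \<kappa> + 1) * (b\<^sup>2 / q\<^sup>2)"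
      by (simp add: add_divide_distrib distrib_right)
    also have "\<kappa> * (a\<^sup>2 / q\<^sup>2) \<le> \<kappa> * (a\<^sup>2 / p\<^sup>2)"
      using \<kappa>(1) p(1) q(1) pq by (intro mult_left_mono divide_left_mono power_mono) auto
    also have "(1 / \<kappa> + 1) * (b\<^sup>2 / q\<^sup>2) \<le> (1 / \<kappa> + 1) * (L\<^sup>2 * \<alpha>\<^sup>2 * (u\<^sup>2 / (p\<^sup>2 * q\<^sup>2)))"
    proof -
      have "b\<^sup>2 / q\<^sup>2 = L\<^sup>2 * \<alpha>\<^sup>2 * (u\<^sup>2 / (q\<^sup>2 * q\<^sup>2))"
        by (simp add: b_def power_mult_distrib power_divide)
      also have "u\<^sup>2 / (q\<^sup>2 * q\<^sup>2) \<le> u\<^sup>2 / (p\<^sup>2 * q\<^sup>2)"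
        using p q pq by (intro divide_left_mono mult_right_mono power_mono) auto
      finally have "b\<^sup>2 / q\<^sup>2 \<le> L\<^sup>2 * \<alpha>\<^sup>2 * (u\<^sup>2 / (p\<^sup>2 * q\<^sup>2))"
        by (simp add: mult_left_mono)
      then show ?thesis using \<kappa>(1) by (intro mult_left_mono) auto
    qed
    finally show ?thesis
      using \<kappa>(1) by (simp add: gap2 mult_ac)
  qed
  have "\<sigma>0 * (a'\<^sup>2 / q\<^sup>2) \<le> \<sigma>0 * (a\<^sup>2 / q\<^sup>2) + \<sigma>0 * \<kappa> * (a\<^sup>2 / p\<^sup>2)
      + \<sigma>0 * L\<^sup>2 * \<alpha>\<^sup>2 * (1 / \<kappa> + 1) * (1 / p\<^sup>2 - 1 / q\<^sup>2)"
    using mult_left_mono[OF gradient_change \<sigma>(1)] by (simp add: distrib_left mult_ac)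
  also have "\<sigma>0 * \<kappa> * (a\<^sup>2 / p\<^sup>2) \<le> 1 / 4 * (a\<^sup>2 / p\<^sup>2)"
    using \<kappa> by (intro mult_right_mono) auto
  finally have change: "\<sigma>0 * (a'\<^sup>2 / q\<^sup>2) + Q * (1 / p\<^sup>2 - 1 / q\<^sup>2)
     \<le> \<sigma>0 * (a\<^sup>2 / p\<^sup>2) + 1 / 4 * (a\<^sup>2 / p\<^sup>2)
      + (\<sigma>1 + 1 + \<sigma>0 * L\<^sup>2 * \<alpha>\<^sup>2 * (1 / \<kappa> + 1)) * (1 / p\<^sup>2 - 1 / q\<^sup>2)"
    by (simp add: Q_def algebra_simps)
  define c where "c = \<sigma>1 + 1 + \<sigma>0 * L\<^sup>2 * \<alpha>\<^sup>2 * (1 / \<kappa> + 1)"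
  have "\<alpha> * (a * (u\<^sup>2 / (p\<^sup>2 * q)) + \<sigma>0 * (a'\<^sup>2 / q\<^sup>2)) \<le> \<alpha> * (1 / 4 * (a\<^sup>2 / (Q * p\<^sup>2) * u\<^sup>2)
      + \<sigma>0 * (a\<^sup>2 / p\<^sup>2) + 1 / 4 * (a\<^sup>2 / p\<^sup>2) + c * (1 / p\<^sup>2 - 1 / q\<^sup>2))"
    using young change alpha_pos unfolding c_def by (intro mult_left_mono) auto
  with value_step have "g (x (Suc k)) / q + \<alpha> * \<sigma>0 * (a'\<^sup>2 / q\<^sup>2) + \<alpha> * c / q\<^sup>2 + L * \<alpha>\<^sup>2 / q
     \<le> g (x k) / p + \<alpha> * \<sigma>0 * (a\<^sup>2 / p\<^sup>2) + \<alpha> * c / p\<^sup>2 + L * \<alpha>\<^sup>2 / p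
       - \<alpha> * (G \<bullet> v k / p\<^sup>2) + \<alpha> / 4 * (a\<^sup>2 / (Q * p\<^sup>2) * u\<^sup>2) + \<alpha> / 4 * (a\<^sup>2 / p\<^sup>2)"
    by (simp add: distrib_left right_diff_distrib mult.assoc)
  then show ?thesis
    using p(1) q(1)
    unfolding lyapunov_def c_def \<kappa>(3) Q_def a_def a'_def u_def G_def by (simp add: p(2) q(2))
qed

end

section \<open>Convergence along a regular trajectory\<close>

text \<open>The almost sure properties from which convergence follows deterministically. The series over the
steep region are required only for the countably many thresholds \<open>1 / (j + 1)\<close>, since the noise series converge
conditionally and an exceptional null set has to be removed for each threshold.\<close>

locale adagrad_regular_path = adagrad_path +
  fixes D0 D1 :: real
  assumes D0_pos: "D0 > 0" and D1_pos: "D1 > 0"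
    and bounded_near_critical: "(norm (gradg (x k)))\<^sup>2 < D0 \<Longrightarrow> (norm (v k))\<^sup>2 < D1"
    and summable_gradient: "summable (\<lambda>k. (norm (gradg (x k)))\<^sup>2 / s k)"
    and summable_steep_inverse: "summable (\<lambda>k. indicat_real (steep (inverse (real (Suc j)))) (x k) *
        ((norm (v k))\<^sup>2 / s k))"
    and summable_radial_noise: "summable (\<lambda>k. indicat_real (steep (inverse (real (Suc j)))) (x k) *
        (gradg (x k) \<bullet> (v k - gradg (x k)) / root_g (x k) / sqrt (s k)))"
    and summable_noise: "summable (\<lambda>k. (indicat_real (steep (inverse (real (Suc j)))) (x k) / sqrt (s k)) *\<^sub>R
        (v k - gradg (x k)))"
begin

lemma summable_steep:
  assumes "\<nu> > 0"
  shows "summable (\<lambda>k. indicat_real (steep \<nu>) (x k) * ((norm (v k))\<^sup>2 / s k))"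
proof -
  obtain j where j: "inverse (real (Suc j)) < \<nu>" using reals_Archimedean[OF assms] by blast
  show ?thesis
  proof (rule summable_comparison_test[OF _ summable_steep_inverse[of j]], intro exI allI impI)
    fix k
    have "indicat_real (steep \<nu>) (x k) \<le> indicat_real (steep (inverse (real (Suc j)))) (x k)"
      using j by (auto simp: indicator_def steep_def)
    then show "norm (indicat_real (steep \<nu>) (x k) * ((norm (v k))\<^sup>2 / s k))
        \<le> indicat_real (steep (inverse (real (Suc j)))) (x k) * ((norm (v k))\<^sup>2 / s k)"
      using s_pos[of k] by (simp add: mult_right_mono divide_right_mono abs_mult)
  qed
qed

text \<open>Sum \<open>root_g_step\<close> over the excursion; the errors are a segment of a convergent series.\<close>

lemma excursion_descent:
  assumes "\<nu> > 0" "\<epsilon> > 0"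
  shows "\<exists>N. \<forall>n\<ge>N. \<forall>m\<ge>n. (\<forall>k\<in>{n..<m}. x k \<in> steep \<nu>) \<longrightarrow>
    root_g (x m) \<le> root_g (x n)
      - \<alpha> / 2 * (\<Sum>k=n..<m. (norm (gradg (x k)))\<^sup>2 / (sqrt (s k) * root_g (x k))) + \<epsilon>"
proof -
  obtain j where j: "inverse (real (Suc j)) < \<nu>" using reals_Archimedean[OF assms(1)] by blast
  define \<mu> where "\<mu> = inverse (real (Suc j))"
  have steep_subset: "steep \<nu> \<subseteq> steep \<mu>" using j by (auto simp: steep_def \<mu>_def)
  define C where "C = \<alpha> / 2 * sqrt (2 * L) + L / 4 * \<alpha>\<^sup>2"
  define e where "e k = C * (indicat_real (steep \<mu>) (x k) * ((norm (v k))\<^sup>2 / s k))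
     - \<alpha> / 2 * (indicat_real (steep \<mu>) (x k) *
        (gradg (x k) \<bullet> (v k - gradg (x k)) / root_g (x k) / sqrt (s k)))" for k
  have "summable e"
    unfolding e_def \<mu>_def by (intro summable_diff summable_mult summable_steep_inverse summable_radial_noise)
  then obtain N where N: "\<And>n m. n \<ge> N \<Longrightarrow> norm (sum e {n..<m}) < \<epsilon>"
    using assms(2) unfolding summable_Cauchy by blast
  have "root_g (x m) \<le> root_g (x n)
      - \<alpha> / 2 * (\<Sum>k=n..<m. (norm (gradg (x k)))\<^sup>2 / (sqrt (s k) * root_g (x k))) + sum e {n..<m}"
    if "n \<le> m" "\<forall>k\<in>{n..<m}. x k \<in> steep \<mu>" for n m
    using that
  proof (induction m rule: dec_induct)
    case base
    then show ?case by simp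
  next
    case (step m)
    then have "indicat_real (steep \<mu>) (x m) = 1" by simp
    then show ?case
      using step root_g_step[of m] by (simp add: e_def C_def algebra_simps)
  qed
  then show ?thesis
    using N steep_subset by (smt (verit, best) real_norm_def subsetD)
qed

lemma excursion_displacement:
  assumes "\<nu> > 0" "\<epsilon> > 0"
  shows "\<exists>N. \<forall>n\<ge>N. \<forall>m\<ge>n. (\<forall>k\<in>{n..<m}. x k \<in> steep \<nu>) \<longrightarrow>
    norm (x m - x n) \<le> \<alpha> * (\<Sum>k=n..<m. norm (gradg (x k)) / sqrt (s k)) + \<epsilon>"
proof -
  obtain j where j: "inverse (real (Suc j)) < \<nu>" using reals_Archimedean[OF assms(1)] by blast
  define \<mu> where "\<mu> = inverse (real (Suc j))"
  have steep_subset: "steep \<nu> \<subseteq> steep \<mu>" using j by (auto simp: steep_def \<mu>_def)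
  define y where "y k = \<alpha> *\<^sub>R ((indicat_real (steep \<mu>) (x k) / sqrt (s k)) *\<^sub>R (v k - gradg (x k)))" for k
  define e where "e k = \<alpha> * (indicat_real (steep \<mu>) (x k) * ((norm (v k))\<^sup>2 / s k))" for k
  have "summable y" "summable e"
    unfolding e_def y_def \<mu>_def
    by (intro summable_mult summable_scaleR_right summable_steep_inverse summable_noise)+
  then obtain N1 N2 where N: "\<And>n m. n \<ge> N1 \<Longrightarrow> norm (sum y {n..<m}) < \<epsilon> / 2"
      "\<And>n m. n \<ge> N2 \<Longrightarrow> norm (sum e {n..<m}) < \<epsilon> / 2"
    using assms(2) by (metis half_gt_zero summable_Cauchy)
  have "norm (x m - x n) \<le> \<alpha> * (\<Sum>k=n..<m. norm (gradg (x k)) / sqrt (s k)) + \<epsilon>"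
    if nm: "n \<ge> max N1 N2" "n \<le> m" and steep: "\<forall>k\<in>{n..<m}. x k \<in> steep \<mu>" for n m
  proof -
    have "x m - x n = (\<Sum>k=n..<m. x (Suc k) - x k)"
      using nm by (simp add: sum_Suc_diff')
    also have "\<dots> = (\<Sum>k=n..<m. x (Suc k) - x k + y k) - sum y {n..<m}"
      by (simp add: sum.distrib)
    also have "norm \<dots> \<le> norm (\<Sum>k=n..<m. x (Suc k) - x k + y k) + norm (sum y {n..<m})"
      by (rule norm_triangle_ineq4)
    also have "norm (\<Sum>k=n..<m. x (Suc k) - x k + y k)
        \<le> (\<Sum>k=n..<m. \<alpha> * (norm (gradg (x k)) / sqrt (s k)) + e k)"
    proof (rule sum_norm_le)
      fix k assume "k \<in> {n..<m}"
      then show "norm (x (Suc k) - x k + y k) \<le> \<alpha> * (norm (gradg (x k)) / sqrt (s k)) + e k"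
        using displacement_step[of k] steep by (simp add: y_def e_def)
    qed
    also have "\<dots> = \<alpha> * (\<Sum>k=n..<m. norm (gradg (x k)) / sqrt (s k)) + sum e {n..<m}"
      by (simp add: sum.distrib sum_distrib_left)
    finally show ?thesis
      using N(1)[of n m] N(2)[of n m] nm by simp
  qed
  then show ?thesis using steep_subset by blast
qed

lemma gradient_tendsto_0_if_bounded:
  assumes "\<And>k. s k \<le> B"
  shows "(\<lambda>k. norm (gradg (x k))) \<longlonglongrightarrow> 0"
proof -
  have "(\<lambda>k. B * ((norm (gradg (x k)))\<^sup>2 / s k)) \<longlonglongrightarrow> B * 0"
    by (intro tendsto_mult_left summable_LIMSEQ_zero summable_gradient)
  then have "(\<lambda>k. sqrt (B * ((norm (gradg (x k)))\<^sup>2 / s k))) \<longlonglongrightarrow> sqrt 0"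
    by (intro tendsto_real_sqrt) simp
  moreover have "norm (gradg (x k)) \<le> sqrt (B * ((norm (gradg (x k)))\<^sup>2 / s k))" for k
  proof (rule real_le_rsqrt)
    have "s k * ((norm (gradg (x k)))\<^sup>2 / s k) \<le> B * ((norm (gradg (x k)))\<^sup>2 / s k)"
      using s_pos[of k] assms[of k] by (intro mult_right_mono) auto
    then show "(norm (gradg (x k)))\<^sup>2 \<le> B * ((norm (gradg (x k)))\<^sup>2 / s k)"
      using s_pos[of k] by simp
  qed
  ultimately show ?thesis
    by (auto intro: Lim_null_comparison[rotated])
qed

context
  assumes s_unbounded: "filterlim s at_top sequentially"
begin

text \<open>Steps taken where the gradient is small use a bounded stochastic gradient and a diverging normalisation; for the others
the squares of the step lengths are summable.\<close>

lemma step_tendsto_0: "(\<lambda>k. norm (v k) / sqrt (s (Suc k))) \<longlonglongrightarrow> 0"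
proof (rule tendsto_sandwich[OF _ _ tendsto_const])
  let ?b = "\<lambda>k. sqrt D1 / sqrt (s k) + sqrt (indicat_real (steep (D0 / 2)) (x k) * ((norm (v k))\<^sup>2 / s k))"
  have "(\<lambda>k. sqrt D1 / sqrt (s k)) \<longlonglongrightarrow> 0"
    by (intro real_tendsto_divide_at_top[OF tendsto_const] filterlim_compose[OF sqrt_at_top s_unbounded])
  moreover have "(\<lambda>k. sqrt (indicat_real (steep (D0 / 2)) (x k) * ((norm (v k))\<^sup>2 / s k))) \<longlonglongrightarrow> sqrt 0"
    using D0_pos by (intro tendsto_real_sqrt summable_LIMSEQ_zero summable_steep) simp
  ultimately show "?b \<longlonglongrightarrow> 0"
    using tendsto_add by fastforce
  have "norm (v k) / sqrt (s (Suc k)) \<le> ?b k" for k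
  proof -
    have le: "norm (v k) / sqrt (s (Suc k)) \<le> norm (v k) / sqrt (s k)"
      using s_pos[of k] s_pos[of "Suc k"] monoD[OF incseq_s, of k "Suc k"] by (intro divide_left_mono) auto
    show ?thesis
    proof (cases "(norm (gradg (x k)))\<^sup>2 < D0")
      case True
      then have "norm (v k) \<le> sqrt D1"
        using bounded_near_critical[of k] by (intro real_le_rsqrt) auto
      then have "norm (v k) / sqrt (s k) \<le> sqrt D1 / sqrt (s k)"
        using s_pos[of k] by (intro divide_right_mono) auto
      moreover have "0 \<le> sqrt (indicat_real (steep (D0 / 2)) (x k) * ((norm (v k))\<^sup>2 / s k))"
        using s_pos[of k] by simp
      ultimately show ?thesis using le by linarith
    next
      case False
      then have "indicat_real (steep (D0 / 2)) (x k) = 1"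
        using D0_pos by (simp add: steep_def)
      then have "sqrt (indicat_real (steep (D0 / 2)) (x k) * ((norm (v k))\<^sup>2 / s k)) = norm (v k) / sqrt (s k)"
        by (simp add: real_sqrt_divide)
      moreover have "0 \<le> sqrt D1 / sqrt (s k)" using s_pos[of k] D1_pos by simp
      ultimately show ?thesis using le by linarith
    qed
  qed
  then show "\<forall>\<^sub>F k in sequentially. norm (v k) / sqrt (s (Suc k)) \<le> ?b k" by simp
  show "\<forall>\<^sub>F k in sequentially. 0 \<le> norm (v k) / sqrt (s (Suc k))"
    using s_pos[THEN less_imp_le] by simp
qed

text \<open>Otherwise \<open>\<parallel>v k\<parallel>\<^sup>2 / s k\<close>, the relative increment of \<open>s\<close>, is eventually summable, and \<open>s\<close> is bounded.\<close>

lemma frequently_near_critical: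
  assumes "\<nu> > 0"
  shows "\<exists>k\<ge>N. x k \<notin> steep \<nu>"
proof (rule ccontr)
  assume "\<not> ?thesis"
  then have steep: "x k \<in> steep \<nu>" if "k \<ge> N" for k using that by auto
  define t where "t k = indicat_real (steep \<nu>) (x k) * ((norm (v k))\<^sup>2 / s k)" for k
  have t: "summable t" "\<And>k. 0 \<le> t k"
    using summable_steep[OF assms] s_pos[THEN less_imp_le] unfolding t_def by simp_all
  have "ln (s k) \<le> ln (s N) + sum t {N..<k}" if "N \<le> k" for k
    using that
  proof (induction k rule: dec_induct)
    case (step k)
    have "s (Suc k) = s k * (1 + t k)"
      using steep[of k] step s_pos[of k] by (simp add: t_def s_Suc field_simps)
    then have "ln (s (Suc k)) = ln (s k) + ln (1 + t k)"
      using s_pos[of k] t(2)[of k] by (simp add: ln_mult)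
    also have "\<dots> \<le> ln (s k) + t k"
      using ln_add_one_self_le_self[OF t(2)] by simp
    finally show ?case using step by simp
  qed simp
  moreover have "sum t {N..<k} \<le> suminf t" for k
    using t by (intro sum_le_suminf) auto
  ultimately have "ln (s k) \<le> ln (s N) + suminf t" if "N \<le> k" for k
    using that by (meson add_left_mono order_trans)
  then have "s k \<le> exp (ln (s N) + suminf t)" if "N \<le> k" for k
    using that s_pos[of k] by (metis exp_le_cancel_iff exp_ln)
  moreover have "\<forall>\<^sub>F k in sequentially. exp (ln (s N) + suminf t) < s k"
    using s_unbounded by (simp add: filterlim_at_top_dense)
  ultimately show False
    by (metis (mono_tags, lifting) eventually_sequentially linorder_not_less nle_le)
qed

text \<open>Small steps cannot jump over the band, and while the trajectory is inside the band it is on an excursion, during which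
\<open>root_g\<close> grows by at most the vanishing error.\<close>

lemma no_upcrossing:
  assumes "p < q" "\<nu> > 0" and steep: "\<And>y. p \<le> root_g y \<Longrightarrow> root_g y \<le> q \<Longrightarrow> y \<in> steep \<nu>"
  shows "(\<forall>\<^sub>F k in sequentially. p \<le> root_g (x k)) \<or> (\<forall>\<^sub>F k in sequentially. root_g (x k) \<le> q)"
proof (rule ccontr)
  assume "\<not> ?thesis"
  then have below: "\<exists>k\<ge>N. root_g (x k) < p" and above: "\<exists>k\<ge>N. q < root_g (x k)" for N
    by (auto simp: eventually_sequentially not_le)
  let ?r = "\<lambda>k. root_g (x k)"
  define \<epsilon> where "\<epsilon> = (q - p) / 3"
  have \<epsilon>: "0 < \<epsilon>" "q = p + 3 * \<epsilon>" using assms(1) by (simp_all add: \<epsilon>_def field_simps)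
  obtain N1 where N1: "\<And>n m. n \<ge> N1 \<Longrightarrow> m \<ge> n \<Longrightarrow> \<forall>k\<in>{n..<m}. x k \<in> steep \<nu> \<Longrightarrow>
      ?r m \<le> ?r n - \<alpha> / 2 * (\<Sum>k=n..<m. (norm (gradg (x k)))\<^sup>2 / (sqrt (s k) * ?r k)) + \<epsilon>"
    using excursion_descent[OF \<open>\<nu> > 0\<close> \<epsilon>(1)] by blast
  let ?j = "\<lambda>k. \<alpha> / 2 * sqrt (2 * L) * (norm (v k) / sqrt (s (Suc k))) +
      L / 4 * \<alpha>\<^sup>2 * (norm (v k) / sqrt (s (Suc k)))\<^sup>2"
  have "?j \<longlonglongrightarrow> \<alpha> / 2 * sqrt (2 * L) * 0 + L / 4 * \<alpha>\<^sup>2 * 0\<^sup>2"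
    by (intro tendsto_intros step_tendsto_0)
  then have "\<forall>\<^sub>F k in sequentially. ?j k < \<epsilon>"
    using \<epsilon> by (intro order_tendstoD) auto
  then obtain N2 where N2: "\<And>k. k \<ge> N2 \<Longrightarrow> ?j k < \<epsilon>"
    by (auto simp: eventually_sequentially)
  have jump: "?r (Suc k) \<le> ?r k + \<epsilon>" if "k \<ge> N2" for k
  proof -
    define d where "d = x (Suc k) - x k"
    have "?r (Suc k) = root_g (x k + d)" by (simp add: d_def)
    also have "\<dots> \<le> ?r k + gradg (x k) \<bullet> d / (2 * ?r k) + L / 4 * (norm d)\<^sup>2"
      by (rule root_g_descent)
    also have "gradg (x k) \<bullet> d / (2 * ?r k) \<le> norm (gradg (x k)) * norm d / (2 * ?r k)"
      using root_g_pos[of "x k"] by (intro divide_right_mono norm_cauchy_schwarz) auto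
    also have "\<dots> = (norm (gradg (x k)) / ?r k) * (norm d / 2)" by simp
    also have "\<dots> \<le> sqrt (2 * L) * (norm d / 2)"
      by (intro mult_right_mono gradient_over_root_g) auto
    finally have "?r (Suc k) \<le> ?r k + ?j k"
      unfolding d_def step_length power_mult_distrib by (simp add: mult_ac)
    with N2[OF that] show ?thesis by simp
  qed
  obtain n where n: "n \<ge> max N1 N2" "?r n < p" using below by blast
  obtain m0 where m0: "m0 \<ge> n" "q < ?r m0" using above by blast
  \<comment> \<open>Isolate the crossing: \<open>m\<close> is the first time above the band, \<open>j\<close> the last time below it before \<open>m\<close>.\<close>
  define m where "m = (LEAST m. n \<le> m \<and> q < ?r m)"
  have m: "n \<le> m" "q < ?r m"
    using LeastI[of "\<lambda>m. n \<le> m \<and> q < ?r m" m0] m0 by (auto simp: m_def)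
  have before_m: "?r k \<le> q" if "n \<le> k" "k < m" for k
    using not_less_Least[of k "\<lambda>m. n \<le> m \<and> q < ?r m"] that by (auto simp: m_def)
  have "n < m" using m n assms by (cases "n = m") auto
  define A where "A = {k \<in> {n..<m}. ?r k < p}"
  define j where "j = Max A"
  have A: "finite A" "n \<in> A" using n \<open>n < m\<close> by (auto simp: A_def)
  then have "j \<in> A" unfolding j_def by (intro Max_in) auto
  then have j: "n \<le> j" "j < m" "?r j < p" by (auto simp: A_def)
  have after_j: "p \<le> ?r k" if "j < k" "k < m" for k
  proof (rule ccontr)
    assume "\<not> p \<le> ?r k"
    then have "k \<in> A" using that j by (auto simp: A_def)
    then have "k \<le> j" unfolding j_def using A by (intro Max_ge) auto
    with that show False by simp
  qed
  have "?r m \<le> ?r (Suc j) - \<alpha> / 2 * (\<Sum>k=Suc j..<m. (norm (gradg (x k)))\<^sup>2 / (sqrt (s k) * ?r k)) + \<epsilon>"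
    using n j by (intro N1 ballI steep after_j before_m) auto
  moreover have "0 \<le> (\<Sum>k=Suc j..<m. (norm (gradg (x k)))\<^sup>2 / (sqrt (s k) * ?r k))"
    using s_pos[THEN less_imp_le] root_g_pos[THEN less_imp_le] by (intro sum_nonneg) simp
  then have "0 \<le> \<alpha> / 2 * (\<Sum>k=Suc j..<m. (norm (gradg (x k)))\<^sup>2 / (sqrt (s k) * ?r k))"
    using alpha_pos by simp
  moreover have "?r (Suc j) \<le> ?r j + \<epsilon>" using jump j n by simp
  ultimately show False using m j \<epsilon> by linarith
qed

text \<open>The band from \<open>K + 1\<close> to \<open>K + 2\<close> has no critical points, and the trajectory is infinitely often below it.\<close>

lemma eventually_root_g_le:
  assumes "\<eta> > 0" and K: "\<And>y. y \<notin> steep \<eta> \<Longrightarrow> root_g y \<le> K"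
  shows "\<forall>\<^sub>F k in sequentially. root_g (x k) \<le> K + 2"
proof -
  have "\<not> (\<forall>\<^sub>F k in sequentially. K + 1 \<le> root_g (x k))"
    using frequently_near_critical[OF assms(1)] K unfolding eventually_sequentially
    by (smt (verit))
  then show ?thesis
    using no_upcrossing[of "K + 1" "K + 2" \<eta>] assms by force
qed

text \<open>If the lower and upper limits differed, a band without critical points between them would be crossed
infinitely often.\<close>

lemma convergent_root_g:
  assumes gap: "\<And>p q. 0 \<le> p \<Longrightarrow> p < q \<Longrightarrow>
      \<exists>p' q' \<nu>. p \<le> p' \<and> p' < q' \<and> q' \<le> q \<and> \<nu> > 0 \<and>
        (\<forall>y. p' \<le> root_g y \<longrightarrow> root_g y \<le> q' \<longrightarrow> y \<in> steep \<nu>)"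
    and B: "\<forall>\<^sub>F k in sequentially. root_g (x k) \<le> B"
  shows "convergent (\<lambda>k. root_g (x k))"
proof -
  define f where "f k = ereal (root_g (x k))" for k
  have lower: "1 \<le> liminf f"
    unfolding f_def by (intro Liminf_bounded always_eventually) (simp add: root_g_ge_1)
  have upper: "limsup f \<le> ereal B"
    unfolding f_def using B by (intro Limsup_bounded) simp
  have "limsup f \<le> liminf f"
  proof (rule ccontr)
    assume "\<not> ?thesis"
    then have "liminf f < limsup f" by simp
    then obtain p where p: "liminf f < ereal p" "ereal p < limsup f" using ereal_dense2 by blast
    then obtain q where q: "ereal p < ereal q" "ereal q < limsup f" using ereal_dense2 by blast
    have "1 < ereal p" using lower p(1) by (rule le_less_trans)
    then have "0 \<le> p" by simp
    then obtain p' q' \<nu> where g: "p \<le> p'" "p' < q'" "q' \<le> q" "\<nu> > 0"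
        "\<And>y. p' \<le> root_g y \<Longrightarrow> root_g y \<le> q' \<Longrightarrow> y \<in> steep \<nu>"
      using gap[of p q] q(1) by auto
    consider "\<forall>\<^sub>F k in sequentially. p' \<le> root_g (x k)" | "\<forall>\<^sub>F k in sequentially. root_g (x k) \<le> q'"
      using no_upcrossing[OF g(2,4,5)] by blast
    then show False
    proof cases
      case 1
      then have "ereal p' \<le> liminf f" unfolding f_def by (intro Liminf_bounded) simp
      with p(1) g(1) show False by (metis ereal_less_eq(3) leD order_trans)
    next
      case 2
      then have "limsup f \<le> ereal q'" unfolding f_def by (intro Limsup_bounded) simp
      with q(2) g(3) show False by (metis ereal_less_eq(3) leD order_trans)
    qed
  qed
  then have eq: "liminf f = limsup f"
    by (intro antisym Liminf_le_Limsup) auto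
  then have lim: "f \<longlonglongrightarrow> limsup f"
    by (simp add: tendsto_iff_Liminf_eq_Limsup)
  have "\<bar>limsup f\<bar> \<noteq> \<infinity>"
    using lower upper eq by (cases "limsup f") auto
  then obtain l where "limsup f = ereal l" by (cases "limsup f") auto
  with lim have "(\<lambda>k. ereal (root_g (x k))) \<longlonglongrightarrow> ereal l"
    by (simp add: f_def[abs_def])
  then show ?thesis
    unfolding lim_ereal convergent_def by blast
qed

text \<open>If the norm of the gradient exceeds \<open>2 b\<close> infinitely often, it also rises from \<open>b\<close> to \<open>2 b\<close> infinitely often. By the
Lipschitz condition such an excursion covers a distance of order \<open>b / L\<close>, so \<open>root_g\<close> loses at least \<open>\<delta>\<close> during it,
however late it takes place.\<close>

lemma gradient_tendsto_0_if_convergent: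
  assumes conv: "convergent (\<lambda>k. root_g (x k))"
  shows "(\<lambda>k. norm (gradg (x k))) \<longlonglongrightarrow> 0"
proof (rule ccontr)
  let ?a = "\<lambda>k. norm (gradg (x k))" and ?r = "\<lambda>k. root_g (x k)"
  assume "\<not> ?a \<longlonglongrightarrow> 0"
  then obtain \<rho> where \<rho>: "0 < \<rho>" "\<And>N. \<exists>k\<ge>N. \<rho> \<le> ?a k"
    by (auto simp: LIMSEQ_iff not_less)
  define b where "b = \<rho> / 2"
  have b: "0 < b" and large: "\<exists>k\<ge>N. 2 * b \<le> ?a k" for N
    using \<rho> by (auto simp: b_def)
  have steep_iff: "y \<in> steep (b\<^sup>2) \<longleftrightarrow> b < norm (gradg y)" for y
    using b by (auto simp: steep_def intro: power_strict_mono dest: power2_less_imp_less)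
  obtain B where B: "\<And>k. ?r k \<le> B"
    using convergent_imp_Bseq[OF conv] unfolding Bseq_def by (auto intro: order_trans[OF abs_ge_self])
  have "0 < B" using B[of 0] root_g_pos[of "x 0"] by linarith
  \<comment> \<open>The loss \<open>(\<alpha> / 2) (b / B) (b / (2 L \<alpha>))\<close> of an excursion along which \<open>\<alpha> \<Sum> \<parallel>\<nabla>g(x k)\<parallel> / sqrt (s k)\<close> is at least \<open>b / (2 L)\<close>.\<close>
  define \<delta> where "\<delta> = b\<^sup>2 / (4 * L * B)"
  have \<delta>: "0 < \<delta>" using b \<open>0 < B\<close> L_pos by (simp add: \<delta>_def)
  obtain N1 where N1: "\<And>n m. n \<ge> N1 \<Longrightarrow> m \<ge> n \<Longrightarrow> \<forall>k\<in>{n..<m}. x k \<in> steep (b\<^sup>2) \<Longrightarrow>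
      ?r m \<le> ?r n - \<alpha> / 2 * (\<Sum>k=n..<m. (?a k)\<^sup>2 / (sqrt (s k) * ?r k)) + \<delta> / 4"
    using excursion_descent[of "b\<^sup>2" "\<delta> / 4"] b \<delta> by auto
  have "0 < b / (4 * L)" using b L_pos by simp
  then obtain N2 where N2: "\<And>n m. n \<ge> N2 \<Longrightarrow> m \<ge> n \<Longrightarrow> \<forall>k\<in>{n..<m}. x k \<in> steep (b\<^sup>2) \<Longrightarrow>
      norm (x m - x n) \<le> \<alpha> * (\<Sum>k=n..<m. ?a k / sqrt (s k)) + b / (4 * L)"
    using excursion_displacement[of "b\<^sup>2" "b / (4 * L)"] b by auto
  have "(\<lambda>k. \<alpha> * (norm (v k) / sqrt (s (Suc k)))) \<longlonglongrightarrow> \<alpha> * 0"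
    by (intro tendsto_intros step_tendsto_0)
  then have "\<forall>\<^sub>F k in sequentially. \<alpha> * (norm (v k) / sqrt (s (Suc k))) < b / (4 * L)"
    using \<open>0 < b / (4 * L)\<close> by (intro order_tendstoD) auto
  then obtain N3 where N3: "\<And>k. k \<ge> N3 \<Longrightarrow> norm (x (Suc k) - x k) < b / (4 * L)"
    by (auto simp: eventually_sequentially step_length)
  have "Cauchy ?r" using conv by (rule convergent_Cauchy)
  then obtain N4 where N4: "\<And>n m. n \<ge> N4 \<Longrightarrow> m \<ge> N4 \<Longrightarrow> \<bar>?r m - ?r n\<bar> < \<delta> / 4"
    using \<delta> unfolding Cauchy_def dist_real_def by (metis divide_pos_pos zero_less_numeral)
  define N where "N = Max {N1, N2, N3, N4}"
  have N: "N1 \<le> N" "N2 \<le> N" "N3 \<le> N" "N4 \<le> N" by (auto simp: N_def)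
  obtain n where n: "n \<ge> N" "x n \<notin> steep (b\<^sup>2)"
    using frequently_near_critical[of "b\<^sup>2" N] b by auto
  obtain m where m: "m \<ge> n" "2 * b \<le> ?a m" using large by blast
  have "n < m" using n m b by (cases "n = m") (auto simp: steep_iff)
  define A where "A = {k \<in> {n..<m}. x k \<notin> steep (b\<^sup>2)}"
  define j where "j = Max A"
  have A: "finite A" "n \<in> A" using n \<open>n < m\<close> by (auto simp: A_def)
  then have "j \<in> A" unfolding j_def by (intro Max_in) auto
  then have j: "n \<le> j" "j < m" "?a j \<le> b" by (auto simp: A_def steep_iff)
  have steep: "\<forall>k\<in>{Suc j..<m}. x k \<in> steep (b\<^sup>2)"
  proof (rule ballI, rule ccontr)
    fix k assume k: "k \<in> {Suc j..<m}" "x k \<notin> steep (b\<^sup>2)"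
    then have "k \<in> A" using j by (auto simp: A_def)
    then have "k \<le> j" unfolding j_def using A by (intro Max_ge) auto
    with k show False by simp
  qed
  have lip: "norm (gradg y) \<le> norm (gradg z) + L * norm (y - z)" for y z
    using gradient_lipschitz[of y z] norm_triangle_sub[of "gradg y" "gradg z"] by linarith
  have "?a (Suc j) \<le> b + L * (b / (4 * L))"
    using lip[of "x (Suc j)" "x j"] mult_left_mono[OF less_imp_le[OF N3[of j]], of L] j n N L_pos
    by linarith
  then have "2 * b \<le> 5 * b / 4 + L * norm (x m - x (Suc j))"
    using lip[of "x m" "x (Suc j)"] m L_pos by simp
  then have "3 * b / (4 * L) \<le> norm (x m - x (Suc j))"
    using L_pos by (simp add: field_simps)
  also have "\<dots> \<le> \<alpha> * (\<Sum>k=Suc j..<m. ?a k / sqrt (s k)) + b / (4 * L)"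
    using N2[OF _ _ steep] j n N by simp
  finally have "b / (2 * L) \<le> \<alpha> * (\<Sum>k=Suc j..<m. ?a k / sqrt (s k))"
    by (simp add: field_simps)
  then have "b / (2 * B) * (b / (2 * L)) \<le> b / (2 * B) * (\<alpha> * (\<Sum>k=Suc j..<m. ?a k / sqrt (s k)))"
    using b \<open>0 < B\<close> by (intro mult_left_mono) auto
  then have "\<delta> \<le> \<alpha> / 2 * (\<Sum>k=Suc j..<m. b / B * (?a k / sqrt (s k)))"
    by (simp only: \<delta>_def power2_eq_square sum_distrib_left[symmetric]) (simp add: mult_ac)
  also have "\<dots> \<le> \<alpha> / 2 * (\<Sum>k=Suc j..<m. (?a k)\<^sup>2 / (sqrt (s k) * ?r k))"
  proof (intro mult_left_mono sum_mono)
    fix k assume "k \<in> {Suc j..<m}"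
    then have "b < ?a k" using steep by (auto simp: steep_iff)
    then have "b * ?a k / (B * sqrt (s k)) \<le> (?a k * ?a k) / (?r k * sqrt (s k))"
      using b B[of k] root_g_pos[of "x k"] s_pos[of k]
      by (intro frac_le mult_right_mono) auto
    then show "b / B * (?a k / sqrt (s k)) \<le> (?a k)\<^sup>2 / (sqrt (s k) * ?r k)"
      by (simp add: power2_eq_square mult_ac)
  qed (use alpha_pos in simp)
  finally have "?r m \<le> ?r (Suc j) - \<delta> + \<delta> / 4"
    using N1[OF _ _ steep] j n N by simp
  then show False
    using N4[of "Suc j" m] j n N \<delta> by simp
qed

end

end

lemma (in adagrad_regular_path) gradient_tendsto_0:
  assumes eta: "\<eta> > 0" "Liminf at_infinity (\<lambda>y. ereal ((norm (gradg y))\<^sup>2)) > ereal \<eta>"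
    and coercive: "filterlim g at_top at_infinity"
    and critical: "nowhere_dense {g y | y. gradg y = 0}"
  shows "(\<lambda>k. norm (gradg (x k))) \<longlonglongrightarrow> 0"
proof (cases "\<exists>B. \<forall>k. s k \<le> B")
  case True
  then show ?thesis using gradient_tendsto_0_if_bounded by blast
next
  case False
  have s_unbounded: "filterlim s at_top sequentially"
    unfolding filterlim_at_top eventually_sequentially
    using False incseq_s by (meson incseqD linear order_trans)
  obtain K where "\<And>y. y \<notin> steep \<eta> \<Longrightarrow> root_g y \<le> K"
    using root_g_bounded_near_critical[OF eta(2)] by blast
  then have "\<forall>\<^sub>F k in sequentially. root_g (x k) \<le> K + 2"
    using eta(1) s_unbounded by (intro eventually_root_g_le)
  then have "convergent (\<lambda>k. root_g (x k))"
    using s_unbounded noncritical_band[OF coercive critical] by (intro convergent_root_g)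
  then show ?thesis
    using s_unbounded by (intro gradient_tendsto_0_if_convergent)
qed

section \<open>Almost sure convergence of martingale series\<close>

lemma integrable_mult_of_square_integrable:
  fixes f h :: "'b \<Rightarrow> real"
  assumes [measurable]: "f \<in> borel_measurable M" "h \<in> borel_measurable M"
    and "integrable M (\<lambda>w. (f w)\<^sup>2)" "integrable M (\<lambda>w. (h w)\<^sup>2)"
  shows "integrable M (\<lambda>w. f w * h w)"
proof (rule Bochner_Integration.integrable_bound)
  show "integrable M (\<lambda>w. (f w)\<^sup>2 + (h w)\<^sup>2)" using assms by simp
  have "\<bar>f w * h w\<bar> \<le> (f w)\<^sup>2 + (h w)\<^sup>2" for w
  proof -
    have "2 * \<bar>f w * h w\<bar> \<le> (f w)\<^sup>2 + (h w)\<^sup>2"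
      using sum_squares_bound[of "\<bar>f w\<bar>" "\<bar>h w\<bar>"] by (simp add: abs_mult)
    then show ?thesis by linarith
  qed
  then show "AE w in M. norm (f w * h w) \<le> norm ((f w)\<^sup>2 + (h w)\<^sup>2)" by simp
qed simp

locale filtered_prob_space = prob_space M for M :: "'w measure" +
  fixes F :: "nat \<Rightarrow> 'w measure"
  assumes subalgebra_F: "subalgebra M (F k)"
    and F_Suc: "sets (F k) \<subseteq> sets (F (Suc k))"
begin

lemma space_F: "space (F k) = space M"
  using subalgebra_F by (simp add: subalgebra_def)

lemma F_mono: "k \<le> n \<Longrightarrow> sets (F k) \<subseteq> sets (F n)"
  using F_Suc by (rule lift_Suc_mono_le)

lemma measurable_F_mono: "k \<le> n \<Longrightarrow> f \<in> borel_measurable (F k) \<Longrightarrow> f \<in> borel_measurable (F n)"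
  using measurable_mono[of borel borel "F k" "F n"] F_mono[of k n] by (auto simp: space_F)

lemma measurable_F_imp: "f \<in> borel_measurable (F k) \<Longrightarrow> f \<in> borel_measurable M"
  using subalgebra_F by (rule measurable_from_subalg)

lemma sigma_finite_subalgebra_F: "sigma_finite_subalgebra M (F k)"
  using finite_measure_axioms subalgebra_F
  by (intro finite_measure_subalgebra_is_sigma_finite)
    (simp add: finite_measure_subalgebra_def finite_measure_subalgebra_axioms_def)

end

text \<open>Orthogonality to the square integrable functions of the past expresses that the conditional expectation of
\<open>X k\<close> given \<open>F k\<close> vanishes, in the form in which it is used.\<close>

locale martingale_differences = filtered_prob_space M F
  for M :: "'w measure" and F :: "nat \<Rightarrow> 'w measure" +
  fixes X :: "nat \<Rightarrow> 'w \<Rightarrow> real"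
  assumes adapted: "X k \<in> borel_measurable (F (Suc k))"
    and square_integrable: "integrable M (\<lambda>w. (X k w)\<^sup>2)"
    and orthogonal: "Y \<in> borel_measurable (F k) \<Longrightarrow> integrable M (\<lambda>w. (Y w)\<^sup>2) \<Longrightarrow>
      expectation (\<lambda>w. Y w * X k w) = 0"
begin

lemma measurable_X [measurable]: "X k \<in> borel_measurable M"
  using adapted by (rule measurable_F_imp)

lemma shift: "martingale_differences M (\<lambda>k. F (m + k)) (\<lambda>k. X (m + k))"
proof
  show "expectation (\<lambda>w. Y w * X (m + k) w) = 0"
    if "Y \<in> borel_measurable (F (m + k))" "integrable M (\<lambda>w. (Y w)\<^sup>2)" for k Y
    using that by (rule orthogonal)
qed (use subalgebra_F F_Suc adapted square_integrable in auto)

text \<open>Kolmogorov's inequality: the partial sums stopped when they first reach \<open>\<epsilon>\<close> have orthogonal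
increments, which bounds their second moment, and Chebyshev's inequality applies to the final stopped sum.\<close>

lemma maximal_inequality:
  assumes "\<epsilon> > 0"
  shows "prob {w \<in> space M. \<exists>n\<le>N. \<epsilon> \<le> \<bar>\<Sum>k<n. X k w\<bar>} \<le> (\<Sum>k<N. expectation (\<lambda>w. (X k w)\<^sup>2)) / \<epsilon>\<^sup>2"
proof -
  define T where "T n w = (\<Sum>k<n. X k w)" for n w
  have T_F: "T i \<in> borel_measurable (F k)" if "i \<le> k" for i k
    unfolding T_def using that by (intro borel_measurable_sum measurable_F_mono[OF _ adapted]) auto
  define B where "B k = {w \<in> space M. \<forall>i\<le>k. \<bar>T i w\<bar> < \<epsilon>}" for k
  have B_F: "B k \<in> sets (F k)" for k
  proof -
    have "{w \<in> space (F k). \<forall>i\<in>{..k}. \<bar>T i w\<bar> < \<epsilon>} \<in> sets (F k)"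
    proof (rule sets.sets_Collect_finite_All)
      fix i assume "i \<in> {..k}"
      then have [measurable]: "T i \<in> borel_measurable (F k)" by (intro T_F) simp
      show "{w \<in> space (F k). \<bar>T i w\<bar> < \<epsilon>} \<in> sets (F k)" by measurable
    qed simp
    also have "{w \<in> space (F k). \<forall>i\<in>{..k}. \<bar>T i w\<bar> < \<epsilon>} = B k"
      by (auto simp: B_def space_F)
    finally show ?thesis .
  qed
  have B_M [measurable]: "B k \<in> sets M" for k
    using B_F subalgebra_F by (auto simp: subalgebra_def)
  \<comment> \<open>The stopped partial sums: \<open>X k\<close> is added as long as the threshold has not been reached.\<close>
  define R where "R n w = (\<Sum>k<n. indicat_real (B k) w * X k w)" for n w
  have R_F: "R n \<in> borel_measurable (F n)" for n
    unfolding R_def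
  proof (rule borel_measurable_sum)
    fix k assume "k \<in> {..<n}"
    then have "B k \<in> sets (F n)" "X k \<in> borel_measurable (F n)"
      using B_F F_mono[of k n] measurable_F_mono[OF _ adapted, of k n] by auto
    then show "(\<lambda>w. indicat_real (B k) w * X k w) \<in> borel_measurable (F n)"
      by measurable
  qed
  have R_M [measurable]: "R n \<in> borel_measurable M" for n
    using R_F by (rule measurable_F_imp)
  have second_moment: "integrable M (\<lambda>w. (R n w)\<^sup>2) \<and>
      expectation (\<lambda>w. (R n w)\<^sup>2) \<le> (\<Sum>k<n. expectation (\<lambda>w. (X k w)\<^sup>2))" for n
  proof (induction n)
    case 0
    then show ?case by (simp add: R_def)
  next
    case (Suc n)
    let ?b = "indicat_real (B n)"
    have b2: "(?b w)\<^sup>2 = ?b w" for w by (simp add: indicator_def)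
    have split: "(R (Suc n) w)\<^sup>2 = (R n w)\<^sup>2 + 2 * ((R n w * ?b w) * X n w) + ?b w * (X n w)\<^sup>2" for w
      using b2[of w] by (simp add: R_def power2_sum power_mult_distrib)
    have int_Rb: "integrable M (\<lambda>w. (R n w * ?b w)\<^sup>2)"
      by (rule Bochner_Integration.integrable_bound[OF conjunct1[OF Suc]]) (auto simp: indicator_def)
    have int_cross: "integrable M (\<lambda>w. (R n w * ?b w) * X n w)"
      using int_Rb square_integrable by (intro integrable_mult_of_square_integrable) auto
    have int_X: "integrable M (\<lambda>w. ?b w * (X n w)\<^sup>2)"
      by (rule Bochner_Integration.integrable_bound[OF square_integrable[of n]]) (auto simp: indicator_def)
    have [measurable]: "B n \<in> sets (F n)" "R n \<in> borel_measurable (F n)"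
      by (rule B_F R_F)+
    have "expectation (\<lambda>w. (R n w * ?b w) * X n w) = 0"
      by (intro orthogonal int_Rb) measurable
    moreover have "expectation (\<lambda>w. ?b w * (X n w)\<^sup>2) \<le> expectation (\<lambda>w. (X n w)\<^sup>2)"
      using int_X square_integrable by (intro integral_mono) (auto simp: indicator_def)
    ultimately show ?case
      using Suc int_cross int_X by (simp add: split)
  qed
  let ?A = "{w \<in> space M. \<exists>n\<le>N. \<epsilon> \<le> \<bar>T n w\<bar>}"
  have [measurable]: "T i \<in> borel_measurable M" for i
    unfolding T_def by measurable
  have stopped: "\<epsilon> \<le> \<bar>R N w\<bar>" if w: "w \<in> ?A" for w
  proof -
    obtain n0 where n0: "n0 \<le> N" "\<epsilon> \<le> \<bar>T n0 w\<bar>" using w by auto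
    define n where "n = (LEAST n. \<epsilon> \<le> \<bar>T n w\<bar>)"
    have n: "\<epsilon> \<le> \<bar>T n w\<bar>" "n \<le> n0"
      unfolding n_def using n0(2) by (auto intro: LeastI Least_le)
    have before: "\<bar>T i w\<bar> < \<epsilon>" if "i < n" for i
      using not_less_Least[of i "\<lambda>n. \<epsilon> \<le> \<bar>T n w\<bar>"] that by (simp add: n_def)
    have B: "w \<in> B k \<longleftrightarrow> k < n" for k
      using w n before unfolding B_def by (auto simp: not_less[symmetric])
    have "R N w = (\<Sum>k<N. if k < n then X k w else 0)"
      unfolding R_def by (intro sum.cong) (auto simp: B)
    also have "\<dots> = (\<Sum>k<n. X k w)"
      using n n0 by (intro sum.mono_neutral_cong_right) auto
    finally show ?thesis using n by (simp add: T_def)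
  qed
  have "\<epsilon>\<^sup>2 * prob ?A = expectation (\<lambda>w. \<epsilon>\<^sup>2 * indicat_real ?A w)"
    by simp
  also have "\<dots> \<le> expectation (\<lambda>w. (R N w)\<^sup>2)"
  proof (rule integral_mono)
    show "\<epsilon>\<^sup>2 * indicat_real ?A w \<le> (R N w)\<^sup>2" for w
      using stopped[of w] assms power_mono[of \<epsilon> "\<bar>R N w\<bar>" 2] by (cases "w \<in> ?A") auto
  qed (use second_moment in \<open>auto intro!: integrable_real_indicator simp: emeasure_eq_measure\<close>)
  also have "\<dots> \<le> (\<Sum>k<N. expectation (\<lambda>w. (X k w)\<^sup>2))"
    using second_moment by blast
  finally show ?thesis
    using assms by (simp add: T_def pos_le_divide_eq mult.commute)
qed

lemma AE_eventually_small:
  assumes summable: "summable (\<lambda>k. expectation (\<lambda>w. (X k w)\<^sup>2))" and "\<epsilon> > 0"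
  shows "AE w in M. \<exists>m. \<forall>n. \<bar>\<Sum>k<n. X (m + k) w\<bar> < \<epsilon>"
proof -
  let ?e = "\<lambda>k. expectation (\<lambda>w. (X k w)\<^sup>2)"
  define A where "A m N = {w \<in> space M. \<exists>n\<le>N. \<epsilon> \<le> \<bar>\<Sum>k<n. X (m + k) w\<bar>}" for m N :: nat
  have A_sets [measurable]: "A m N \<in> sets M" for m N unfolding A_def by measurable
  have tail_bound: "prob (\<Union>N. A m N) \<le> (\<Sum>k. ?e (k + m)) / \<epsilon>\<^sup>2" for m
  proof (rule LIMSEQ_le_const2)
    show "(\<lambda>N. prob (A m N)) \<longlonglongrightarrow> prob (\<Union>N. A m N)"
    proof (rule finite_Lim_measure_incseq)
      show "incseq (A m)" by (intro incseq_SucI) (auto simp: A_def intro: le_SucI)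
    qed auto
    have "prob (A m N) \<le> (\<Sum>k. ?e (k + m)) / \<epsilon>\<^sup>2" for N
    proof -
      interpret tail: martingale_differences M "\<lambda>k. F (m + k)" "\<lambda>k. X (m + k)"
        by (rule shift)
      have "prob (A m N) \<le> (\<Sum>k<N. ?e (m + k)) / \<epsilon>\<^sup>2"
        unfolding A_def by (rule tail.maximal_inequality[OF \<open>\<epsilon> > 0\<close>])
      also have "(\<Sum>k<N. ?e (m + k)) \<le> (\<Sum>k. ?e (k + m))"
        using summable summable_iff_shift[of ?e m] by (simp add: add.commute sum_le_suminf)
      finally show ?thesis using \<open>\<epsilon> > 0\<close> by (simp add: divide_right_mono)
    qed
    then show "\<exists>N. \<forall>n\<ge>N. prob (A m n) \<le> (\<Sum>k. ?e (k + m)) / \<epsilon>\<^sup>2" by blast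
  qed
  define Z where "Z = (\<Inter>m. \<Union>N. A m N)"
  have [measurable]: "Z \<in> sets M" unfolding Z_def by measurable
  have "prob Z \<le> (\<Sum>k. ?e (k + m)) / \<epsilon>\<^sup>2" for m
    using finite_measure_mono[of Z "\<Union>N. A m N"] tail_bound[of m] by (force simp: Z_def)
  moreover have "(\<lambda>m. (\<Sum>k. ?e (k + m)) / \<epsilon>\<^sup>2) \<longlonglongrightarrow> 0"
    using tendsto_divide[OF suminf_exist_split2[OF summable] tendsto_const[of "\<epsilon>\<^sup>2"]] \<open>\<epsilon> > 0\<close>
    by simp
  ultimately have "prob Z \<le> 0"
    by (meson LIMSEQ_le_const)
  then have "Z \<in> null_sets M"
    by (intro null_setsI) (auto simp: emeasure_eq_measure measure_le_0_iff)
  then show ?thesis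
    by (rule AE_I') (force simp: Z_def A_def not_less)
qed

text \<open>The maximal inequality for the tails makes the partial sums Cauchy almost surely.\<close>

theorem AE_summable:
  assumes "summable (\<lambda>k. expectation (\<lambda>w. (X k w)\<^sup>2))"
  shows "AE w in M. summable (\<lambda>k. X k w)"
proof -
  have "AE w in M. \<forall>j. \<exists>m. \<forall>n. \<bar>\<Sum>k<n. X (m + k) w\<bar> < inverse (real (Suc j))"
    unfolding AE_all_countable using assms by (intro allI AE_eventually_small) auto
  then show ?thesis
  proof eventually_elim
    case (elim w)
    show ?case
      unfolding summable_Cauchy
    proof (intro allI impI)
      fix e :: real assume "e > 0"
      then obtain j where j: "inverse (real (Suc j)) < e / 2"
        using reals_Archimedean[of "e / 2"] by auto
      obtain m where m: "\<And>n. \<bar>\<Sum>k<n. X (m + k) w\<bar> < e / 2"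
        using elim j by (meson order_less_trans)
      have from_m: "\<bar>\<Sum>k=m..<n. X k w\<bar> < e / 2" if "m \<le> n" for n
        using m[of "n - m"] that sum.shift_bounds_nat_ivl[of "\<lambda>k. X k w" 0 m "n - m"]
        by (simp add: atLeast0LessThan add.commute)
      have "norm (\<Sum>k=n..<n'. X k w) < e" if "m \<le> n" for n n'
      proof (cases "n \<le> n'")
        case True
        then have "(\<Sum>k=m..<n'. X k w) = (\<Sum>k=m..<n. X k w) + (\<Sum>k=n..<n'. X k w)"
          using that by (simp add: sum.atLeastLessThan_concat)
        then show ?thesis
          using from_m[OF that] from_m[of n'] that True unfolding real_norm_def by linarith
      qed (use \<open>e > 0\<close> in simp)
      then show "\<exists>N. \<forall>n\<ge>N. \<forall>n'. norm (\<Sum>k=n..<n'. X k w) < e" by blast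
    qed
  qed
qed

end

section \<open>Regularity of almost every trajectory\<close>

lemma (in prob_space) AE_summable_nonneg:
  fixes f :: "nat \<Rightarrow> 'a \<Rightarrow> real"
  assumes int: "\<And>k. integrable M (f k)" and nonneg: "\<And>k w. w \<in> space M \<Longrightarrow> 0 \<le> f k w"
    and sum: "summable (\<lambda>k. expectation (f k))"
  shows "AE w in M. summable (\<lambda>k. f k w)"
proof -
  have [measurable]: "f k \<in> borel_measurable M" for k using int by auto
  have "(\<integral>\<^sup>+ w. (\<Sum>k. ennreal (f k w)) \<partial>M) = (\<Sum>k. \<integral>\<^sup>+ w. ennreal (f k w) \<partial>M)"
    by (rule nn_integral_suminf) simp
  also have "\<dots> = (\<Sum>k. ennreal (expectation (f k)))"
    using int nonneg by (intro suminf_cong nn_integral_eq_integral) auto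
  also have "\<dots> = ennreal (\<Sum>k. expectation (f k))"
    using nonneg by (intro suminf_ennreal2 sum integral_nonneg_AE) auto
  finally have "(\<integral>\<^sup>+ w. (\<Sum>k. ennreal (f k w)) \<partial>M) \<noteq> \<infinity>" by simp
  then have "AE w in M. (\<Sum>k. ennreal (f k w)) \<noteq> \<infinity>"
    by (intro nn_integral_PInf_AE) auto
  then show ?thesis
    using AE_space
  proof eventually_elim
    case (elim w)
    then show ?case using nonneg by (intro summable_suminf_not_top) auto
  qed
qed

text \<open>The process over a general filtration: \<open>x k\<close> and \<open>s k\<close> are known at time \<open>k\<close>, whereas \<open>v k\<close> is revealed at time \<open>Suc k\<close>.\<close>

locale adagrad_process = smooth_objective g gradg L + filtered_prob_space M F
  for g :: "'a::euclidean_space \<Rightarrow> real" and gradg :: "'a \<Rightarrow> 'a" and L :: real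
    and M :: "'w measure" and F :: "nat \<Rightarrow> 'w measure" +
  fixes x v :: "nat \<Rightarrow> 'w \<Rightarrow> 'a" and s :: "nat \<Rightarrow> 'w \<Rightarrow> real"
    and \<alpha> \<sigma>0 \<sigma>1 s0 :: real and x0 :: 'a
  assumes x_F: "x k \<in> borel_measurable (F k)"
    and s_F: "s k \<in> borel_measurable (F k)"
    and v_F: "v k \<in> borel_measurable (F (Suc k))"
    and path: "w \<in> space M \<Longrightarrow> adagrad_path g gradg L (\<lambda>k. x k w) (\<lambda>k. v k w) (\<lambda>k. s k w) \<alpha>"
    and x_0: "w \<in> space M \<Longrightarrow> x 0 w = x0"
    and s_0: "w \<in> space M \<Longrightarrow> s 0 w = s0"
    and sigma_nonneg: "0 \<le> \<sigma>0" "0 \<le> \<sigma>1"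
    and unbiased: "AE w in M. vec_cond_exp M (F k) (v k) w = gradg (x k w)"
    and second_moment: "AE w in M. nn_cond_exp M (F k) (\<lambda>w. ennreal ((norm (v k w))\<^sup>2)) w
        \<le> ennreal (\<sigma>0 * (norm (gradg (x k w)))\<^sup>2 + \<sigma>1)"
begin

lemma measurable_path [measurable]:
  "x k \<in> borel_measurable M" "s k \<in> borel_measurable M" "v k \<in> borel_measurable M"
  using x_F s_F v_F by (auto intro: measurable_F_imp)

lemma s_ge_s0: "w \<in> space M \<Longrightarrow> s0 \<le> s k w"
  using incseqD[OF adagrad_path.incseq_s[OF path], of w 0 k] by (simp add: s_0)

lemma s_pos: "w \<in> space M \<Longrightarrow> 0 < s k w"
  using adagrad_path.s_pos[OF path] by blast

lemma s_nonneg: "w \<in> space M \<Longrightarrow> 0 \<le> s k w"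
  using s_pos by (rule less_imp_le)

lemma s0_pos: "0 < s0"
  using not_empty s_pos[of _ 0] s_0 by force

lemma alpha_pos: "0 < \<alpha>"
  using not_empty adagrad_path.alpha_pos[OF path] by blast

text \<open>No step is longer than \<open>\<alpha>\<close>, so each iterate is a bounded random variable. Together with the second moment
condition this makes every quantity below integrable.\<close>

lemma distance_bound: "w \<in> space M \<Longrightarrow> norm (x k w - x0) \<le> real k * \<alpha>"
proof (induction k)
  case (Suc k)
  interpret adagrad_path g gradg L "\<lambda>k. x k w" "\<lambda>k. v k w" "\<lambda>k. s k w" \<alpha>
    using Suc.prems by (rule path)
  have "norm (x (Suc k) w - x k w) \<le> \<alpha>"
    unfolding step_length using relative_step_le_1[of k] alpha_pos by (intro mult_left_le) auto
  then show ?case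
    using Suc norm_triangle_ineq[of "x (Suc k) w - x k w" "x k w - x0"] by (simp add: algebra_simps)
qed (simp add: x_0)

lemma bounded_on_path:
  fixes f :: "'a \<Rightarrow> real"
  assumes "continuous_on UNIV f"
  obtains B where "\<And>w. w \<in> space M \<Longrightarrow> \<bar>f (x k w)\<bar> \<le> B"
proof -
  have "compact (f ` cball x0 (real k * \<alpha>))"
    using assms by (intro compact_continuous_image compact_cball) (auto intro: continuous_on_subset)
  then obtain B where "\<forall>y\<in>f ` cball x0 (real k * \<alpha>). norm y \<le> B"
    using compact_imp_bounded bounded_iff by metis
  moreover have "x k w \<in> cball x0 (real k * \<alpha>)" if "w \<in> space M" for w
    using distance_bound[OF that, of k] by (simp add: dist_norm norm_minus_commute)
  ultimately show ?thesis by (intro that[of B]) auto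
qed

lemma integrable_bounded:
  fixes f :: "'w \<Rightarrow> real"
  assumes "f \<in> borel_measurable M" "\<And>w. w \<in> space M \<Longrightarrow> \<bar>f w\<bar> \<le> B"
  shows "integrable M f"
  using assms by (intro integrable_const_bound[of _ B]) auto

lemma over_s_bound: "w \<in> space M \<Longrightarrow> 0 \<le> c \<Longrightarrow> c \<le> B \<Longrightarrow> c / s k w \<le> B / s0"
  using s_ge_s0 s0_pos by (intro frac_le) auto

lemma gradient_squared_bound:
  obtains B where "\<And>w. w \<in> space M \<Longrightarrow> (norm (gradg (x k w)))\<^sup>2 \<le> B"
proof -
  have "continuous_on UNIV (\<lambda>y. (norm (gradg y))\<^sup>2)"
    by (intro continuous_intros continuous_gradg)
  then show thesis
    using bounded_on_path[of "\<lambda>y. (norm (gradg y))\<^sup>2" k] that by (metis abs_of_nonneg zero_le_power2)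
qed

lemma integrable_gradient_over_s: "integrable M (\<lambda>w. (norm (gradg (x k w)))\<^sup>2 / s k w)"
proof -
  obtain B where "\<And>w. w \<in> space M \<Longrightarrow> (norm (gradg (x k w)))\<^sup>2 \<le> B"
    using gradient_squared_bound by blast
  then have "\<bar>(norm (gradg (x k w)))\<^sup>2 / s k w\<bar> \<le> B / s0" if "w \<in> space M" for w
    using that s_pos[OF that, of k] by (simp add: over_s_bound)
  then show ?thesis by (intro integrable_bounded) auto
qed

lemma integrable_lyapunov:
  "integrable M (\<lambda>w. adagrad_path.lyapunov g gradg L \<alpha> \<sigma>0 \<sigma>1 (x k w) (s k w))"
proof -
  obtain w0 where "w0 \<in> space M" using not_empty by blast
  note lyapunov_def = adagrad_path.lyapunov_def[OF path[OF this]]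
  obtain B where B: "\<And>w. w \<in> space M \<Longrightarrow> \<bar>g (x k w)\<bar> \<le> B"
    using bounded_on_path[OF continuous_g] by blast
  have inv: "\<bar>1 / s k w\<bar> \<le> 1 / s0" "\<bar>1 / sqrt (s k w)\<bar> \<le> 1 / sqrt s0" "\<bar>g (x k w) / sqrt (s k w)\<bar> \<le> B / sqrt s0"
    if "w \<in> space M" for w
    using that s_ge_s0[OF that, of k] s_pos[OF that, of k] s0_pos B[OF that]
    by (auto intro!: divide_left_mono frac_le)
  have "integrable M (\<lambda>w. 1 / s k w)" "integrable M (\<lambda>w. 1 / sqrt (s k w))"
      "integrable M (\<lambda>w. g (x k w) / sqrt (s k w))"
    using inv by (auto intro!: integrable_bounded)
  then have "integrable M (\<lambda>w. g (x k w) / sqrt (s k w) + \<alpha> * \<sigma>0 * ((norm (gradg (x k w)))\<^sup>2 / s k w)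
     + \<alpha> * (\<sigma>1 + 1 + \<sigma>0 * L\<^sup>2 * \<alpha>\<^sup>2 * (4 * (\<sigma>0 + 1) + 1)) * (1 / s k w) + L * \<alpha>\<^sup>2 * (1 / sqrt (s k w)))"
    using integrable_gradient_over_s
    by (intro Bochner_Integration.integrable_add integrable_mult_right)
  then show ?thesis by (simp add: lyapunov_def)
qed

lemma weighted_second_moment:
  assumes [measurable]: "u \<in> borel_measurable (F k)"
    and u: "\<And>w. w \<in> space M \<Longrightarrow> 0 \<le> u w" "\<And>w. w \<in> space M \<Longrightarrow> u w \<le> B"
  shows "integrable M (\<lambda>w. u w * (norm (v k w))\<^sup>2)"
    and "expectation (\<lambda>w. u w * (norm (v k w))\<^sup>2)
      \<le> expectation (\<lambda>w. u w * (\<sigma>0 * (norm (gradg (x k w)))\<^sup>2 + \<sigma>1))"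
proof -
  interpret cond: sigma_finite_subalgebra M "F k" by (rule sigma_finite_subalgebra_F)
  let ?c = "\<lambda>w. \<sigma>0 * (norm (gradg (x k w)))\<^sup>2 + \<sigma>1"
  have [measurable]: "u \<in> borel_measurable M" by (rule measurable_F_imp) fact
  obtain C where C: "\<And>w. w \<in> space M \<Longrightarrow> (norm (gradg (x k w)))\<^sup>2 \<le> C"
    using gradient_squared_bound by blast
  have bound: "0 \<le> u w * ?c w" "\<bar>u w * ?c w\<bar> \<le> B * (\<sigma>0 * C + \<sigma>1)" if "w \<in> space M" for w
  proof -
    show nn: "0 \<le> u w * ?c w" using u(1)[OF that] sigma_nonneg by simp
    have "u w * ?c w \<le> B * (\<sigma>0 * C + \<sigma>1)"
      using u[OF that] sigma_nonneg C[OF that] by (intro mult_mono add_mono mult_left_mono) auto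
    with nn show "\<bar>u w * ?c w\<bar> \<le> B * (\<sigma>0 * C + \<sigma>1)" by simp
  qed
  have int_c: "integrable M (\<lambda>w. u w * ?c w)"
    using bound(2) by (intro integrable_bounded) auto
  have "(\<integral>\<^sup>+ w. ennreal (u w * (norm (v k w))\<^sup>2) \<partial>M)
      = (\<integral>\<^sup>+ w. ennreal (u w) * ennreal ((norm (v k w))\<^sup>2) \<partial>M)"
    using u by (intro nn_integral_cong) (simp add: ennreal_mult)
  also have "\<dots> = (\<integral>\<^sup>+ w. ennreal (u w) * nn_cond_exp M (F k) (\<lambda>w. ennreal ((norm (v k w))\<^sup>2)) w \<partial>M)"
    by (rule cond.nn_cond_exp_intg[symmetric]) auto
  also have "\<dots> \<le> (\<integral>\<^sup>+ w. ennreal (u w) * ennreal (?c w) \<partial>M)"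
  proof (rule nn_integral_mono_AE)
    show "AE w in M. ennreal (u w) * nn_cond_exp M (F k) (\<lambda>w. ennreal ((norm (v k w))\<^sup>2)) w
        \<le> ennreal (u w) * ennreal (?c w)"
      using second_moment[of k] by eventually_elim (intro mult_left_mono zero_le)
  qed
  also have "\<dots> = (\<integral>\<^sup>+ w. ennreal (u w * ?c w) \<partial>M)"
    using u sigma_nonneg by (intro nn_integral_cong) (simp add: ennreal_mult)
  also have "\<dots> = ennreal (expectation (\<lambda>w. u w * ?c w))"
    using bound(1) by (intro nn_integral_eq_integral int_c) auto
  finally have le: "(\<integral>\<^sup>+ w. ennreal (u w * (norm (v k w))\<^sup>2) \<partial>M) \<le> ennreal (expectation (\<lambda>w. u w * ?c w))" .
  show int: "integrable M (\<lambda>w. u w * (norm (v k w))\<^sup>2)"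
  proof (rule integrableI_nonneg)
    show "(\<integral>\<^sup>+ w. ennreal (u w * (norm (v k w))\<^sup>2) \<partial>M) < \<infinity>"
      using le by (rule le_less_trans) simp
  qed (use u in auto)
  have "ennreal (expectation (\<lambda>w. u w * (norm (v k w))\<^sup>2)) \<le> ennreal (expectation (\<lambda>w. u w * ?c w))"
    using le nn_integral_eq_integral[OF int] u by auto
  moreover have "0 \<le> expectation (\<lambda>w. u w * ?c w)"
    using bound(1) by (intro integral_nonneg_AE) auto
  ultimately show "expectation (\<lambda>w. u w * (norm (v k w))\<^sup>2) \<le> expectation (\<lambda>w. u w * ?c w)"
    by simp
qed

lemma integrable_v_squared: "integrable M (\<lambda>w. (norm (v k w))\<^sup>2)"
  using weighted_second_moment(1)[of "\<lambda>_. 1" k 1] by simp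

text \<open>Only the coordinates of the conditional expectation are given, so the inner product is treated coordinatewise.\<close>

lemma weighted_unbiased:
  fixes z :: "'w \<Rightarrow> 'a"
  assumes z_F [measurable]: "z \<in> borel_measurable (F k)" and z: "integrable M (\<lambda>w. (norm (z w))\<^sup>2)"
  shows "integrable M (\<lambda>w. z w \<bullet> v k w)" "integrable M (\<lambda>w. z w \<bullet> gradg (x k w))"
    and "expectation (\<lambda>w. z w \<bullet> v k w) = expectation (\<lambda>w. z w \<bullet> gradg (x k w))"
proof -
  interpret cond: sigma_finite_subalgebra M "F k" by (rule sigma_finite_subalgebra_F)
  have [measurable]: "z \<in> borel_measurable M" by (rule measurable_F_imp) fact
  have component: "integrable M (\<lambda>w. (y w \<bullet> b)\<^sup>2)"
    if [measurable]: "y \<in> borel_measurable M" and y: "integrable M (\<lambda>w. (norm (y w))\<^sup>2)" and b: "b \<in> Basis"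
    for y :: "'w \<Rightarrow> 'a" and b
  proof (rule Bochner_Integration.integrable_bound[OF y])
    have "(y w \<bullet> b)\<^sup>2 \<le> (norm (y w))\<^sup>2" for w
      using Basis_le_norm[OF b, of "y w"] by (metis abs_norm_cancel power2_abs power_mono abs_ge_zero)
    then show "AE w in M. norm ((y w \<bullet> b)\<^sup>2) \<le> norm ((norm (y w))\<^sup>2)" by simp
  qed simp
  have prod: "integrable M (\<lambda>w. (z w \<bullet> b) * (v k w \<bullet> b))" if "b \<in> Basis" for b
    using component[OF _ z that] component[OF _ integrable_v_squared that]
    by (intro integrable_mult_of_square_integrable) auto
  have cond_b: "AE w in M. real_cond_exp M (F k) (\<lambda>w. v k w \<bullet> b) w = gradg (x k w) \<bullet> b" if "b \<in> Basis" for b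
    using unbiased[of k]
  proof eventually_elim
    case (elim w)
    have "vec_cond_exp M (F k) (v k) w \<bullet> b = real_cond_exp M (F k) (\<lambda>w. v k w \<bullet> b) w"
      using that by (simp add: vec_cond_exp_def inner_sum_left inner_Basis if_distrib sum.delta cong: if_cong)
    with elim show ?case by simp
  qed
  have grad: "integrable M (\<lambda>w. (z w \<bullet> b) * (gradg (x k w) \<bullet> b))"
    "expectation (\<lambda>w. (z w \<bullet> b) * (v k w \<bullet> b)) = expectation (\<lambda>w. (z w \<bullet> b) * (gradg (x k w) \<bullet> b))"
    if b: "b \<in> Basis" for b
  proof -
    have z_b: "(\<lambda>w. z w \<bullet> b) \<in> borel_measurable (F k)" and v_b: "(\<lambda>w. v k w \<bullet> b) \<in> borel_measurable M"
      by measurable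
    have eq: "AE w in M. (z w \<bullet> b) * real_cond_exp M (F k) (\<lambda>w. v k w \<bullet> b) w = (z w \<bullet> b) * (gradg (x k w) \<bullet> b)"
      using cond_b[OF b] by eventually_elim simp
    show "integrable M (\<lambda>w. (z w \<bullet> b) * (gradg (x k w) \<bullet> b))"
      using cond.real_cond_exp_intg(1)[OF prod[OF b] z_b v_b]
      by (rule integrable_cong_AE_imp) (use eq in auto)
    show "expectation (\<lambda>w. (z w \<bullet> b) * (v k w \<bullet> b)) = expectation (\<lambda>w. (z w \<bullet> b) * (gradg (x k w) \<bullet> b))"
      unfolding cond.real_cond_exp_intg(2)[OF prod[OF b] z_b v_b, symmetric]
      by (rule integral_cong_AE) (use eq in auto)
  qed
  have expand: "(\<lambda>w. z w \<bullet> f w) = (\<lambda>w. \<Sum>b\<in>Basis. (z w \<bullet> b) * (f w \<bullet> b))" for f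
    by (intro ext euclidean_inner)
  show "integrable M (\<lambda>w. z w \<bullet> v k w)" "integrable M (\<lambda>w. z w \<bullet> gradg (x k w))"
    by (subst expand, intro Bochner_Integration.integrable_sum prod grad(1), assumption)+
  show "expectation (\<lambda>w. z w \<bullet> v k w) = expectation (\<lambda>w. z w \<bullet> gradg (x k w))"
    by (subst (1 2) expand) (simp add: Bochner_Integration.integral_sum prod grad)
qed

text \<open>Test the conditional mean with \<open>z = \<nabla>g(x k) / s k\<close> and the conditional second moment with the weight \<open>u\<close> of
\<open>\<parallel>v k\<parallel>\<^sup>2\<close> in \<open>lyapunov_step\<close>.\<close>

lemma lyapunov_expectation_step:
  "expectation (\<lambda>w. adagrad_path.lyapunov g gradg L \<alpha> \<sigma>0 \<sigma>1 (x (Suc k) w) (s (Suc k) w))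
    \<le> expectation (\<lambda>w. adagrad_path.lyapunov g gradg L \<alpha> \<sigma>0 \<sigma>1 (x k w) (s k w))
      - \<alpha> / 2 * expectation (\<lambda>w. (norm (gradg (x k w)))\<^sup>2 / s k w)"
proof -
  let ?W = "\<lambda>k w. adagrad_path.lyapunov g gradg L \<alpha> \<sigma>0 \<sigma>1 (x k w) (s k w)"
  let ?a = "\<lambda>w. (norm (gradg (x k w)))\<^sup>2"
  define z where "z w = (1 / s k w) *\<^sub>R gradg (x k w)" for w
  \<comment> \<open>Chosen such that \<open>u (\<sigma>0 \<parallel>\<nabla>g\<parallel>\<^sup>2 + \<sigma>1) \<le> \<parallel>\<nabla>g\<parallel>\<^sup>2 / s\<close>.\<close>
  define u where "u w = ?a w / ((\<sigma>0 * ?a w + \<sigma>1 + 1) * s k w)" for w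
  note [measurable] = x_F[of k] s_F[of k]
  have z_F: "z \<in> borel_measurable (F k)" unfolding z_def by measurable
  have u_F: "u \<in> borel_measurable (F k)" unfolding u_def by measurable
  obtain B where B: "\<And>w. w \<in> space M \<Longrightarrow> ?a w \<le> B"
    using gradient_squared_bound by blast
  have int_z: "integrable M (\<lambda>w. (norm (z w))\<^sup>2)"
  proof (rule integrable_bounded)
    show "(\<lambda>w. (norm (z w))\<^sup>2) \<in> borel_measurable M" unfolding z_def by measurable
    fix w assume w: "w \<in> space M"
    have "(norm (z w))\<^sup>2 = ?a w / (s k w)\<^sup>2"
      by (simp add: z_def power_mult_distrib power_divide)
    also have "\<dots> \<le> B / s0\<^sup>2"
      using B[OF w] s_ge_s0[OF w, of k] s0_pos
      by (intro frac_le power_mono) (auto intro: order_trans[OF zero_le_power2])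
    finally show "\<bar>(norm (z w))\<^sup>2\<bar> \<le> B / s0\<^sup>2" by simp
  qed
  have u: "0 \<le> u w" "u w * (\<sigma>0 * ?a w + \<sigma>1) \<le> ?a w / s k w" "u w \<le> B / s0" if w: "w \<in> space M" for w
  proof -
    define Q where "Q = \<sigma>0 * ?a w + \<sigma>1"
    have Q: "0 \<le> Q" using sigma_nonneg by (simp add: Q_def)
    have u_eq: "u w = ?a w / s k w / (Q + 1)" by (simp add: u_def Q_def mult.commute)
    have pos: "0 \<le> ?a w / s k w" using s_pos[OF w, of k] by simp
    show "0 \<le> u w" unfolding u_eq using pos Q s_nonneg[OF w] by simp
    have "?a w / s k w * (Q / (Q + 1)) \<le> ?a w / s k w * 1"
      using pos Q by (intro mult_left_mono) auto
    then show "u w * (\<sigma>0 * ?a w + \<sigma>1) \<le> ?a w / s k w" unfolding u_eq Q_def[symmetric] by simp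
    have "u w \<le> ?a w / s k w / 1" unfolding u_eq using pos Q by (intro divide_left_mono) auto
    also have "\<dots> \<le> B / s0"
      using over_s_bound[OF w _ B[OF w]] by simp
    finally show "u w \<le> B / s0" .
  qed
  have z_grad: "z w \<bullet> gradg (x k w) = ?a w / s k w" for w
    by (simp add: z_def power2_norm_eq_inner)
  have z_v: "z w \<bullet> v k w = gradg (x k w) \<bullet> v k w / s k w" for w
    by (simp add: z_def)
  note moment = weighted_second_moment[OF u_F u(1,3)]
  note mean = weighted_unbiased[OF z_F int_z]
  have "expectation (\<lambda>w. u w * (\<sigma>0 * ?a w + \<sigma>1)) \<le> expectation (\<lambda>w. ?a w / s k w)"
  proof (rule integral_mono)
    show "integrable M (\<lambda>w. u w * (\<sigma>0 * ?a w + \<sigma>1))"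
    proof (rule Bochner_Integration.integrable_bound[OF integrable_gradient_over_s[of k]])
      show "(\<lambda>w. u w * (\<sigma>0 * ?a w + \<sigma>1)) \<in> borel_measurable M" unfolding u_def by measurable
      show "AE w in M. norm (u w * (\<sigma>0 * ?a w + \<sigma>1)) \<le> norm (?a w / s k w)"
      proof (rule AE_I2)
        fix w assume w: "w \<in> space M"
        have "0 \<le> u w * (\<sigma>0 * ?a w + \<sigma>1)" using u(1)[OF w] sigma_nonneg by simp
        with u(2)[OF w] show "norm (u w * (\<sigma>0 * ?a w + \<sigma>1)) \<le> norm (?a w / s k w)"
          unfolding real_norm_def by linarith
      qed
    qed
  qed (use u(2) integrable_gradient_over_s in auto)
  with moment(2) have moment_le: "expectation (\<lambda>w. u w * (norm (v k w))\<^sup>2) \<le> expectation (\<lambda>w. ?a w / s k w)"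
    by linarith
  have "expectation (?W (Suc k)) \<le> expectation (\<lambda>w. ?W k w - \<alpha> * (z w \<bullet> v k w)
     + \<alpha> / 4 * (u w * (norm (v k w))\<^sup>2) + \<alpha> / 4 * (?a w / s k w))"
  proof (rule integral_mono)
    show "integrable M (\<lambda>w. ?W k w - \<alpha> * (z w \<bullet> v k w)
       + \<alpha> / 4 * (u w * (norm (v k w))\<^sup>2) + \<alpha> / 4 * (?a w / s k w))"
      using integrable_lyapunov mean(1) moment(1) integrable_gradient_over_s
      by (intro Bochner_Integration.integrable_add Bochner_Integration.integrable_diff integrable_mult_right)
    fix w assume "w \<in> space M"
    from adagrad_path.lyapunov_step[OF path[OF this] sigma_nonneg, of k]
    show "?W (Suc k) w \<le> ?W k w - \<alpha> * (z w \<bullet> v k w)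
       + \<alpha> / 4 * (u w * (norm (v k w))\<^sup>2) + \<alpha> / 4 * (?a w / s k w)"
      by (simp only: z_v u_def)
  qed (rule integrable_lyapunov)
  also have "\<dots> = expectation (?W k) - \<alpha> * expectation (\<lambda>w. z w \<bullet> v k w)
     + \<alpha> / 4 * expectation (\<lambda>w. u w * (norm (v k w))\<^sup>2) + \<alpha> / 4 * expectation (\<lambda>w. ?a w / s k w)"
    using integrable_lyapunov[of k] mean(1) moment(1) integrable_gradient_over_s[of k]
    by (simp only: Bochner_Integration.integral_add Bochner_Integration.integral_diff
        Bochner_Integration.integrable_add Bochner_Integration.integrable_diff
        integrable_mult_right integral_mult_right_zero)
  also have "expectation (\<lambda>w. z w \<bullet> v k w) = expectation (\<lambda>w. ?a w / s k w)"
    unfolding mean(3) z_grad ..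
  also have "\<alpha> / 4 * expectation (\<lambda>w. u w * (norm (v k w))\<^sup>2) \<le> \<alpha> / 4 * expectation (\<lambda>w. ?a w / s k w)"
    using alpha_pos by (intro mult_left_mono moment_le) auto
  finally show ?thesis
    by (simp add: algebra_simps)
qed

lemma summable_expected_gradient:
  "summable (\<lambda>k. expectation (\<lambda>w. (norm (gradg (x k w)))\<^sup>2 / s k w))"
proof (rule summableI_nonneg_bounded)
  let ?W = "\<lambda>k. expectation (\<lambda>w. adagrad_path.lyapunov g gradg L \<alpha> \<sigma>0 \<sigma>1 (x k w) (s k w))"
  let ?e = "\<lambda>k. expectation (\<lambda>w. (norm (gradg (x k w)))\<^sup>2 / s k w)"
  show "0 \<le> ?e k" for k
    by (intro integral_nonneg_AE AE_I2) (simp add: s_nonneg)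
  have "?W n \<le> ?W 0 - \<alpha> / 2 * (\<Sum>k<n. ?e k)" for n
  proof (induction n)
    case (Suc n)
    then show ?case using lyapunov_expectation_step[of n] by (simp add: algebra_simps)
  qed simp
  moreover have "0 \<le> ?W n" for n
  proof (intro integral_nonneg_AE AE_I2)
    fix w assume w: "w \<in> space M"
    show "0 \<le> adagrad_path.lyapunov g gradg L \<alpha> \<sigma>0 \<sigma>1 (x n w) (s n w)"
      unfolding adagrad_path.lyapunov_def[OF path[OF w]]
      using s_pos[OF w, of n] alpha_pos sigma_nonneg g_nonneg L_pos by simp
  qed
  ultimately have "\<alpha> / 2 * (\<Sum>k<n. ?e k) \<le> ?W 0" for n
    by (smt (verit))
  then show "(\<Sum>k<n. ?e k) \<le> 2 * ?W 0 / \<alpha>" for n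
    using alpha_pos by (simp add: field_simps)
qed

text \<open>On the steep region the constant \<open>\<sigma>1\<close> of the second moment bound is at most \<open>(\<sigma>1 / \<nu>) \<parallel>\<nabla>g\<parallel>\<^sup>2\<close>.\<close>

lemma steep_weight:
  assumes "\<nu> > 0"
  defines "u \<equiv> \<lambda>k w. indicat_real (steep \<nu>) (x k w) / s k w"
  shows "u k \<in> borel_measurable (F k)"
    and "w \<in> space M \<Longrightarrow> 0 \<le> u k w" "w \<in> space M \<Longrightarrow> u k w \<le> 1 / s0"
    and "integrable M (\<lambda>w. u k w * (norm (v k w))\<^sup>2)"
    and "expectation (\<lambda>w. u k w * (norm (v k w))\<^sup>2)
      \<le> (\<sigma>0 + \<sigma>1 / \<nu>) * expectation (\<lambda>w. (norm (gradg (x k w)))\<^sup>2 / s k w)"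
proof -
  note [measurable] = x_F[of k] s_F[of k]
  show u_F: "u k \<in> borel_measurable (F k)" unfolding u_def by measurable
  show nn: "0 \<le> u k w" if "w \<in> space M" for w using s_pos[OF that, of k] by (simp add: u_def)
  show le: "u k w \<le> 1 / s0" if "w \<in> space M" for w
    using over_s_bound[OF that, of 1 1 k] s0_pos by (auto simp: u_def indicator_def)
  note moment = weighted_second_moment[OF u_F nn le]
  show "integrable M (\<lambda>w. u k w * (norm (v k w))\<^sup>2)" by (rule moment(1))
  let ?a = "\<lambda>w. (norm (gradg (x k w)))\<^sup>2"
  have int: "integrable M (\<lambda>w. (\<sigma>0 + \<sigma>1 / \<nu>) * (?a w / s k w))"
    by (intro integrable_mult_right integrable_gradient_over_s)
  have nonneg: "0 \<le> u k w * (\<sigma>0 * ?a w + \<sigma>1)" if "w \<in> space M" for w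
    using nn[OF that] sigma_nonneg by simp
  have pointwise: "u k w * (\<sigma>0 * ?a w + \<sigma>1) \<le> (\<sigma>0 + \<sigma>1 / \<nu>) * (?a w / s k w)" if w: "w \<in> space M" for w
  proof (cases "x k w \<in> steep \<nu>")
    case True
    then have "\<sigma>1 * 1 \<le> \<sigma>1 * (?a w / \<nu>)"
      using assms(1) sigma_nonneg by (intro mult_left_mono) (auto simp: steep_def)
    then have "\<sigma>0 * ?a w + \<sigma>1 \<le> (\<sigma>0 + \<sigma>1 / \<nu>) * ?a w" by (simp add: distrib_right)
    then have "(\<sigma>0 * ?a w + \<sigma>1) / s k w \<le> (\<sigma>0 + \<sigma>1 / \<nu>) * ?a w / s k w"
      using s_pos[OF w, of k] by (intro divide_right_mono) auto
    with True show ?thesis by (simp add: u_def)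
  qed (use assms(1) sigma_nonneg s_pos[OF w, of k] in \<open>simp add: u_def\<close>)
  have "expectation (\<lambda>w. u k w * (\<sigma>0 * ?a w + \<sigma>1)) \<le> expectation (\<lambda>w. (\<sigma>0 + \<sigma>1 / \<nu>) * (?a w / s k w))"
  proof (rule integral_mono[OF _ int pointwise])
    show "integrable M (\<lambda>w. u k w * (\<sigma>0 * ?a w + \<sigma>1))"
    proof (rule Bochner_Integration.integrable_bound[OF int])
      have [measurable]: "u k \<in> borel_measurable M" using u_F by (rule measurable_F_imp)
      show "(\<lambda>w. u k w * (\<sigma>0 * ?a w + \<sigma>1)) \<in> borel_measurable M" by measurable
      show "AE w in M. norm (u k w * (\<sigma>0 * ?a w + \<sigma>1)) \<le> norm ((\<sigma>0 + \<sigma>1 / \<nu>) * (?a w / s k w))"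
      proof (rule AE_I2)
        fix w assume w: "w \<in> space M"
        show "norm (u k w * (\<sigma>0 * ?a w + \<sigma>1)) \<le> norm ((\<sigma>0 + \<sigma>1 / \<nu>) * (?a w / s k w))"
          using nonneg[OF w] pointwise[OF w] unfolding real_norm_def by linarith
      qed
    qed
  qed
  also have "\<dots> = (\<sigma>0 + \<sigma>1 / \<nu>) * expectation (\<lambda>w. ?a w / s k w)"
    by (rule integral_mult_right_zero)
  finally show "expectation (\<lambda>w. u k w * (norm (v k w))\<^sup>2)
      \<le> (\<sigma>0 + \<sigma>1 / \<nu>) * expectation (\<lambda>w. ?a w / s k w)"
    using moment(2) by linarith
qed

lemma summable_expected_steep:
  assumes "\<nu> > 0"
  shows "summable (\<lambda>k. expectation (\<lambda>w. indicat_real (steep \<nu>) (x k w) / s k w * (norm (v k w))\<^sup>2))"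
proof (rule summable_comparison_test[OF _ summable_mult[OF summable_expected_gradient]], intro exI allI impI)
  fix k
  have "0 \<le> expectation (\<lambda>w. indicat_real (steep \<nu>) (x k w) / s k w * (norm (v k w))\<^sup>2)"
    by (intro integral_nonneg_AE AE_I2) (simp add: s_nonneg)
  then show "norm (expectation (\<lambda>w. indicat_real (steep \<nu>) (x k w) / s k w * (norm (v k w))\<^sup>2))
      \<le> (\<sigma>0 + \<sigma>1 / \<nu>) * expectation (\<lambda>w. (norm (gradg (x k w)))\<^sup>2 / s k w)"
    using steep_weight(5)[OF assms, of k] by simp
qed

lemma AE_summable_gradient: "AE w in M. summable (\<lambda>k. (norm (gradg (x k w)))\<^sup>2 / s k w)"
  by (intro AE_summable_nonneg integrable_gradient_over_s summable_expected_gradient)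
    (simp add: s_nonneg)

lemma AE_summable_steep:
  assumes "\<nu> > 0"
  shows "AE w in M. summable (\<lambda>k. indicat_real (steep \<nu>) (x k w) * ((norm (v k w))\<^sup>2 / s k w))"
proof -
  have "AE w in M. summable (\<lambda>k. indicat_real (steep \<nu>) (x k w) / s k w * (norm (v k w))\<^sup>2)"
    by (intro AE_summable_nonneg steep_weight(4)[OF assms] summable_expected_steep assms)
      (simp add: s_nonneg)
  then show ?thesis by simp
qed

text \<open>These are martingale differences whose variances are dominated by the two summable sequences of
expectations obtained above.\<close>

lemma AE_summable_noise:
  assumes "\<nu> > 0" and z_borel [measurable]: "z \<in> borel_measurable borel" and z: "\<And>y. norm (z y) \<le> C"
  shows "AE w in M. summable (\<lambda>k. indicat_real (steep \<nu>) (x k w) / sqrt (s k w) *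
    (z (x k w) \<bullet> (v k w - gradg (x k w))))"
proof -
  define X where "X k w = indicat_real (steep \<nu>) (x k w) / sqrt (s k w) *
    (z (x k w) \<bullet> (v k w - gradg (x k w)))" for k w
  define y where "y k w = (indicat_real (steep \<nu>) (x k w) / sqrt (s k w)) *\<^sub>R z (x k w)" for k w
  let ?a = "\<lambda>k w. (norm (gradg (x k w)))\<^sup>2"
  define b where "b k w = 2 * C\<^sup>2 * (indicat_real (steep \<nu>) (x k w) / s k w * (norm (v k w))\<^sup>2)
     + 2 * C\<^sup>2 * (?a k w / s k w)" for k w
  have X_eq: "X k w = y k w \<bullet> v k w - y k w \<bullet> gradg (x k w)" for k w
    by (simp add: X_def y_def inner_diff_right right_diff_distrib)
  have C: "0 \<le> C" using z[of 0] norm_ge_zero order_trans by blast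
  have y_F: "y k \<in> borel_measurable (F k)" for k
    using x_F[of k] s_F[of k] unfolding y_def by measurable
  have X_F: "X k \<in> borel_measurable (F (Suc k))" for k
    using measurable_F_mono[OF le_SucI[OF order_refl] x_F[of k]]
      measurable_F_mono[OF le_SucI[OF order_refl] s_F[of k]] v_F[of k]
    unfolding X_def by measurable
  have y_bound: "norm (y k w) \<le> C / sqrt s0" if w: "w \<in> space M" for k w
  proof -
    have "norm (y k w) \<le> 1 / sqrt (s k w) * C"
      using z[of "x k w"] s_pos[OF w, of k] C unfolding y_def norm_scaleR
      by (intro mult_mono) (auto simp: indicator_def)
    also have "\<dots> \<le> C / sqrt s0"
      using s_ge_s0[OF w, of k] s0_pos C by (auto intro: divide_left_mono)
    finally show ?thesis .
  qed
  have X_sq: "(X k w)\<^sup>2 \<le> b k w" if w: "w \<in> space M" for k w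
  proof (cases "x k w \<in> steep \<nu>")
    case True
    have "\<bar>z (x k w) \<bullet> (v k w - gradg (x k w))\<bar> \<le> C * (norm (v k w) + norm (gradg (x k w)))"
      using Cauchy_Schwarz_ineq2[of "z (x k w)" "v k w - gradg (x k w)"] z[of "x k w"] C
        norm_triangle_ineq4[of "v k w" "gradg (x k w)"]
      by (meson mult_mono norm_ge_zero order_trans)
    then have "\<bar>z (x k w) \<bullet> (v k w - gradg (x k w))\<bar>\<^sup>2 \<le> (C * (norm (v k w) + norm (gradg (x k w))))\<^sup>2"
      by (rule power_mono) simp
    also have "\<dots> \<le> C\<^sup>2 * (2 * (norm (v k w))\<^sup>2 + 2 * ?a k w)"
      using sum_squares_bound[of "norm (v k w)" "norm (gradg (x k w))"]
      unfolding power_mult_distrib by (intro mult_left_mono) (auto simp: power2_sum)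
    finally have "(z (x k w) \<bullet> (v k w - gradg (x k w)))\<^sup>2 / s k w
        \<le> C\<^sup>2 * (2 * (norm (v k w))\<^sup>2 + 2 * ?a k w) / s k w"
      using s_pos[OF w, of k] by (simp add: divide_right_mono)
    then show ?thesis
      using True s_pos[OF w, of k]
      by (simp add: X_def b_def power_divide distrib_left add_divide_distrib mult_ac)
  next
    case False
    then show ?thesis using s_pos[OF w, of k] by (simp add: X_def b_def)
  qed
  have int_b: "integrable M (b k)" for k
    unfolding b_def
    by (intro Bochner_Integration.integrable_add integrable_mult_right integrable_gradient_over_s
        steep_weight(4)[OF assms(1)])
  interpret martingale_differences M F X
  proof
    fix k
    show "X k \<in> borel_measurable (F (Suc k))" by (rule X_F)
    have [measurable]: "X k \<in> borel_measurable M" using X_F by (rule measurable_F_imp)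
    show "integrable M (\<lambda>w. (X k w)\<^sup>2)"
    proof (rule Bochner_Integration.integrable_bound[OF int_b[of k]])
      show "AE w in M. norm ((X k w)\<^sup>2) \<le> norm (b k w)"
        using X_sq by (intro AE_I2) (auto intro: order_trans[OF _ abs_ge_self])
    qed simp
    fix Y :: "'w \<Rightarrow> real" assume Y [measurable]: "Y \<in> borel_measurable (F k)" and Y_sq: "integrable M (\<lambda>w. (Y w)\<^sup>2)"
    note [measurable] = y_F[of k]
    have [measurable]: "Y \<in> borel_measurable M" "y k \<in> borel_measurable M"
      by (rule measurable_F_imp[OF Y] measurable_F_imp[OF y_F])+
    have "integrable M (\<lambda>w. (C / sqrt s0)\<^sup>2 * (Y w)\<^sup>2)"
      using Y_sq by (rule integrable_mult_right)
    then have int_Yy: "integrable M (\<lambda>w. (norm (Y w *\<^sub>R y k w))\<^sup>2)"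
    proof (rule Bochner_Integration.integrable_bound)
      show "AE w in M. norm ((norm (Y w *\<^sub>R y k w))\<^sup>2) \<le> norm ((C / sqrt s0)\<^sup>2 * (Y w)\<^sup>2)"
      proof (rule AE_I2)
        fix w assume w: "w \<in> space M"
        have "(norm (y k w))\<^sup>2 * (Y w)\<^sup>2 \<le> (C / sqrt s0)\<^sup>2 * (Y w)\<^sup>2"
          by (intro mult_right_mono power_mono y_bound w) auto
        then show "norm ((norm (Y w *\<^sub>R y k w))\<^sup>2) \<le> norm ((C / sqrt s0)\<^sup>2 * (Y w)\<^sup>2)"
          by (simp add: power_mult_distrib mult.commute)
      qed
    qed simp
    have Yy_F: "(\<lambda>w. Y w *\<^sub>R y k w) \<in> borel_measurable (F k)" by measurable
    note mean = weighted_unbiased[OF Yy_F int_Yy]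
    have "expectation (\<lambda>w. Y w * X k w)
        = expectation (\<lambda>w. (Y w *\<^sub>R y k w) \<bullet> v k w - (Y w *\<^sub>R y k w) \<bullet> gradg (x k w))"
      by (simp add: X_eq right_diff_distrib)
    also have "\<dots> = 0"
      using mean by (subst Bochner_Integration.integral_diff) auto
    finally show "expectation (\<lambda>w. Y w * X k w) = 0" .
  qed
  have "AE w in M. summable (\<lambda>k. X k w)"
  proof (rule AE_summable, rule summable_comparison_test, intro exI allI impI)
    have "summable (\<lambda>k. 2 * C\<^sup>2 * expectation (\<lambda>w. indicat_real (steep \<nu>) (x k w) / s k w * (norm (v k w))\<^sup>2)
        + 2 * C\<^sup>2 * expectation (\<lambda>w. ?a k w / s k w))"
      using summable_expected_steep[OF assms(1)] summable_expected_gradient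
      by (intro summable_add summable_mult)
    also have "(\<lambda>k. 2 * C\<^sup>2 * expectation (\<lambda>w. indicat_real (steep \<nu>) (x k w) / s k w * (norm (v k w))\<^sup>2)
        + 2 * C\<^sup>2 * expectation (\<lambda>w. ?a k w / s k w)) = (\<lambda>k. expectation (b k))"
      unfolding b_def
      by (simp only: Bochner_Integration.integral_add integral_mult_right_zero integrable_mult_right
          steep_weight(4)[OF assms(1)] integrable_gradient_over_s)
    finally show "summable (\<lambda>k. expectation (b k))" .
    fix k
    have "expectation (\<lambda>w. (X k w)\<^sup>2) \<le> expectation (b k)"
      using X_sq by (intro integral_mono square_integrable int_b)
    then show "norm (expectation (\<lambda>w. (X k w)\<^sup>2)) \<le> expectation (b k)"
      by simp
  qed
  then show ?thesis by (simp add: X_def)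
qed

theorem AE_regular_path:
  assumes "D0 > 0" "D1 > 0"
    and bounded: "\<And>k. AE w in M. (norm (gradg (x k w)))\<^sup>2 < D0 \<longrightarrow> (norm (v k w))\<^sup>2 < D1"
  shows "AE w in M. adagrad_regular_path g gradg L (\<lambda>k. x k w) (\<lambda>k. v k w) (\<lambda>k. s k w) \<alpha> D0 D1"
proof -
  let ?\<nu> = "\<lambda>j. inverse (real (Suc j))"
  have bounded': "AE w in M. \<forall>k. (norm (gradg (x k w)))\<^sup>2 < D0 \<longrightarrow> (norm (v k w))\<^sup>2 < D1"
    using bounded by (simp add: AE_all_countable)
  have steep: "AE w in M. \<forall>j. summable (\<lambda>k. indicat_real (steep (?\<nu> j)) (x k w) * ((norm (v k w))\<^sup>2 / s k w))"
    unfolding AE_all_countable by (intro allI AE_summable_steep) simp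
  have radial: "AE w in M. \<forall>j. summable (\<lambda>k. indicat_real (steep (?\<nu> j)) (x k w) / sqrt (s k w) *
      (((1 / root_g (x k w)) *\<^sub>R gradg (x k w)) \<bullet> (v k w - gradg (x k w))))"
    unfolding AE_all_countable
  proof
    fix j
    show "AE w in M. summable (\<lambda>k. indicat_real (steep (?\<nu> j)) (x k w) / sqrt (s k w) *
      (((1 / root_g (x k w)) *\<^sub>R gradg (x k w)) \<bullet> (v k w - gradg (x k w))))"
    proof (rule AE_summable_noise[of _ "\<lambda>y. (1 / root_g y) *\<^sub>R gradg y"])
      show "norm ((1 / root_g y) *\<^sub>R gradg y) \<le> sqrt (2 * L)" for y
        using gradient_over_root_g[of y] root_g_pos[of y] by simp
    qed (simp, measurable)
  qed
  have noise: "AE w in M. \<forall>j. \<forall>b\<in>Basis. summable (\<lambda>k. indicat_real (steep (?\<nu> j)) (x k w) / sqrt (s k w) *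
      (b \<bullet> (v k w - gradg (x k w))))"
    unfolding AE_all_countable
  proof (intro allI AE_finite_allI)
    fix j and b :: 'a assume "b \<in> Basis"
    then show "AE w in M. summable (\<lambda>k. indicat_real (steep (?\<nu> j)) (x k w) / sqrt (s k w) *
      (b \<bullet> (v k w - gradg (x k w))))"
      by (intro AE_summable_noise[of _ "\<lambda>_. b" 1]) auto
  qed simp
  show ?thesis
    using bounded' steep radial noise AE_summable_gradient AE_space
  proof eventually_elim
    case (elim w)
    interpret adagrad_path g gradg L "\<lambda>k. x k w" "\<lambda>k. v k w" "\<lambda>k. s k w" \<alpha>
      using elim by (intro path)
    show ?case
    proof
      fix j
      show "summable (\<lambda>k. indicat_real (steep (?\<nu> j)) (x k w) *
        (gradg (x k w) \<bullet> (v k w - gradg (x k w)) / root_g (x k w) / sqrt (s k w)))"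
        using elim(3) by (simp add: mult_ac)
      have "summable (\<lambda>k. \<Sum>b\<in>Basis. (indicat_real (steep (?\<nu> j)) (x k w) / sqrt (s k w) *
          (b \<bullet> (v k w - gradg (x k w)))) *\<^sub>R b)"
        using elim(4) by (intro summable_sum summable_scaleR_left) blast
      also have "(\<lambda>k. \<Sum>b\<in>Basis. (indicat_real (steep (?\<nu> j)) (x k w) / sqrt (s k w) *
          (b \<bullet> (v k w - gradg (x k w)))) *\<^sub>R b)
        = (\<lambda>k. (indicat_real (steep (?\<nu> j)) (x k w) / sqrt (s k w)) *\<^sub>R (v k w - gradg (x k w)))"
      proof
        fix k
        have "(\<Sum>b\<in>Basis. (indicat_real (steep (?\<nu> j)) (x k w) / sqrt (s k w) *
            (b \<bullet> (v k w - gradg (x k w)))) *\<^sub>R b)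
          = (indicat_real (steep (?\<nu> j)) (x k w) / sqrt (s k w)) *\<^sub>R
              (\<Sum>b\<in>Basis. ((v k w - gradg (x k w)) \<bullet> b) *\<^sub>R b)"
          unfolding scaleR_sum_right by (simp add: inner_commute)
        then show "(\<Sum>b\<in>Basis. (indicat_real (steep (?\<nu> j)) (x k w) / sqrt (s k w) *
            (b \<bullet> (v k w - gradg (x k w)))) *\<^sub>R b)
          = (indicat_real (steep (?\<nu> j)) (x k w) / sqrt (s k w)) *\<^sub>R (v k w - gradg (x k w))"
          by (simp only: euclidean_representation)
      qed
      finally show "summable (\<lambda>k. (indicat_real (steep (?\<nu> j)) (x k w) / sqrt (s k w)) *\<^sub>R
          (v k w - gradg (x k w)))" .
    qed (use elim assms in auto)
  qed
qed

end

section \<open>Convergence of AdaGrad-Norm\<close>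

lemma sets_noise_filtration_mono:
  "m \<le> n \<Longrightarrow> sets (noise_filtration M N \<xi> m) \<subseteq> sets (noise_filtration M N \<xi> n)"
  unfolding sets_noise_filtration by (intro sigma_sets_mono' UN_mono) auto

lemma measurable_noise_filtration:
  assumes "\<xi> k \<in> measurable M N" "1 \<le> k" "k \<le> n"
  shows "\<xi> k \<in> measurable (noise_filtration M N \<xi> n) N"
proof (rule measurableI)
  show "\<xi> k w \<in> space N" if "w \<in> space (noise_filtration M N \<xi> n)" for w
    using that assms(1) by (simp add: measurable_space)
  show "\<xi> k -` A \<inter> space (noise_filtration M N \<xi> n) \<in> sets (noise_filtration M N \<xi> n)"
    if "A \<in> sets N" for A
    unfolding space_noise_filtration sets_noise_filtration
    using that assms(2,3) by (intro sigma_sets.Basic UN_I[of k]) auto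
qed

theorem theorem3p4:
  fixes M :: "'w measure" and N :: "'x measure"
    and g :: "'a::euclidean_space \<Rightarrow> real" and gradg :: "'a \<Rightarrow> 'a"
    and G :: "'a \<Rightarrow> 'x \<Rightarrow> 'a" and \<xi> :: "nat \<Rightarrow> 'w \<Rightarrow> 'x"
    and \<theta> :: "nat \<Rightarrow> 'w \<Rightarrow> 'a" and S :: "nat \<Rightarrow> 'w \<Rightarrow> real"
    and \<theta>1 :: 'a and S0 \<alpha>0 L \<eta> \<sigma>0 \<sigma>1 D0 D1 :: real
  assumes prob: "prob_space M"
    and noise_indep: "prob_space.indep_vars M (\<lambda>_. N) \<xi> {1..}"
    and oracle_measurable: "case_prod G \<in> borel_measurable (borel \<Otimes>\<^sub>M N)"
    and gradient: "\<And>x. GDERIV g x :> gradg x"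
    and gradient_continuous: "continuous_on UNIV gradg"
    and g_nonneg: "\<And>x. 0 \<le> g x"
    and gradient_lipschitz: "\<And>x y. norm (gradg x - gradg y) \<le> L * norm (x - y)"
    and eta_pos: "\<eta> > 0"
    and gradient_liminf: "Liminf at_infinity (\<lambda>x. ereal ((norm (gradg x))\<^sup>2)) > ereal \<eta>"
    and coercive: "filterlim g at_top at_infinity"
    and critical_values: "nowhere_dense {g x | x. gradg x = 0}"
    and S0_pos: "S0 > 0"
    and alpha0_pos: "\<alpha>0 > 0"
    and theta_1: "\<And>\<omega>. \<omega> \<in> space M \<Longrightarrow> \<theta> 1 \<omega> = \<theta>1"
    and S_0: "\<And>\<omega>. \<omega> \<in> space M \<Longrightarrow> S 0 \<omega> = S0"
    and S_step: "\<And>n \<omega>. n \<ge> 1 \<Longrightarrow> \<omega> \<in> space M \<Longrightarrow>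
        S n \<omega> = S (n - 1) \<omega> + (norm (G (\<theta> n \<omega>) (\<xi> n \<omega>)))\<^sup>2"
    and theta_step: "\<And>n \<omega>. n \<ge> 1 \<Longrightarrow> \<omega> \<in> space M \<Longrightarrow>
        \<theta> (n + 1) \<omega> = \<theta> n \<omega> - (\<alpha>0 / sqrt (S n \<omega>)) *\<^sub>R G (\<theta> n \<omega>) (\<xi> n \<omega>)"
    and sigma_nonneg: "\<sigma>0 \<ge> 0" "\<sigma>1 \<ge> 0"
    and D_pos: "D0 > 0" "D1 > 0"
    and unbiased: "\<And>n. n \<ge> 1 \<Longrightarrow> AE \<omega> in M.
        vec_cond_exp M (noise_filtration M N \<xi> (n - 1)) (\<lambda>\<omega>. G (\<theta> n \<omega>) (\<xi> n \<omega>)) \<omega>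
          = gradg (\<theta> n \<omega>)"
    and second_moment: "\<And>n. n \<ge> 1 \<Longrightarrow> AE \<omega> in M.
        nn_cond_exp M (noise_filtration M N \<xi> (n - 1))
            (\<lambda>\<omega>. ennreal ((norm (G (\<theta> n \<omega>) (\<xi> n \<omega>)))\<^sup>2)) \<omega>
          \<le> ennreal (\<sigma>0 * (norm (gradg (\<theta> n \<omega>)))\<^sup>2 + \<sigma>1)"
    and bounded_near_critical: "\<And>n. n \<ge> 1 \<Longrightarrow> AE \<omega> in M.
        (norm (gradg (\<theta> n \<omega>)))\<^sup>2 < D0 \<longrightarrow> (norm (G (\<theta> n \<omega>) (\<xi> n \<omega>)))\<^sup>2 < D1"
  shows "AE \<omega> in M. (\<lambda>n. norm (gradg (\<theta> n \<omega>))) \<longlonglongrightarrow> 0"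
proof -
  interpret prob_space M by (rule prob)
  \<comment> \<open>The estimates divide by the Lipschitz constant.\<close>
  define L' where "L' = max L 1"
  have lipschitz: "norm (gradg x - gradg y) \<le> L' * norm (x - y)" for x y
  proof -
    have "L * norm (x - y) \<le> L' * norm (x - y)"
      unfolding L'_def by (intro mult_right_mono) auto
    with gradient_lipschitz[of x y] show ?thesis by linarith
  qed
  define F where "F = noise_filtration M N \<xi>"
  define x where "x k = \<theta> (Suc k)" for k
  define v where "v k = (\<lambda>\<omega>. G (\<theta> (Suc k) \<omega>) (\<xi> (Suc k) \<omega>))" for k
  have xi_M: "\<xi> k \<in> measurable M N" if "1 \<le> k" for k
    using noise_indep that by (auto simp: indep_vars_def)
  have space_F: "space (F k) = space M" for k
    by (simp add: F_def)
  have F_mono: "measurable (F k) borel \<subseteq> measurable (F (Suc k)) borel" for k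
    unfolding F_def by (intro measurable_mono sets_noise_filtration_mono) auto
  have v_if_x: "v k \<in> borel_measurable (F (Suc k))" if x: "x k \<in> borel_measurable (F k)" for k
  proof -
    have [measurable]: "x k \<in> borel_measurable (F (Suc k))" using F_mono x by blast
    have [measurable]: "\<xi> (Suc k) \<in> measurable (F (Suc k)) N"
      unfolding F_def using xi_M by (intro measurable_noise_filtration) auto
    have "(\<lambda>\<omega>. case_prod G (x k \<omega>, \<xi> (Suc k) \<omega>)) \<in> borel_measurable (F (Suc k))"
      by (rule measurable_compose[OF _ oracle_measurable]) measurable
    then show ?thesis by (simp add: v_def x_def)
  qed
  have adapted: "x k \<in> borel_measurable (F k) \<and> S k \<in> borel_measurable (F k)" for k
  proof (induction k)
    case 0
    have "x 0 \<in> borel_measurable (F 0) \<longleftrightarrow> (\<lambda>_. \<theta>1) \<in> borel_measurable (F 0)"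
      by (intro measurable_cong) (use theta_1 in \<open>simp add: x_def space_F\<close>)
    moreover have "S 0 \<in> borel_measurable (F 0) \<longleftrightarrow> (\<lambda>_. S0) \<in> borel_measurable (F 0)"
      by (intro measurable_cong) (use S_0 in \<open>simp add: space_F\<close>)
    ultimately show ?case by simp
  next
    case (Suc k)
    have [measurable]: "x k \<in> borel_measurable (F (Suc k))" "S k \<in> borel_measurable (F (Suc k))"
        "v k \<in> borel_measurable (F (Suc k))"
      using Suc F_mono v_if_x by blast+
    have "S (Suc k) \<in> borel_measurable (F (Suc k)) \<longleftrightarrow>
        (\<lambda>\<omega>. S k \<omega> + (norm (v k \<omega>))\<^sup>2) \<in> borel_measurable (F (Suc k))"
      by (intro measurable_cong) (use S_step[of "Suc k"] in \<open>simp add: v_def space_F\<close>)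
    then have [measurable]: "S (Suc k) \<in> borel_measurable (F (Suc k))" by simp
    have "x (Suc k) \<in> borel_measurable (F (Suc k)) \<longleftrightarrow>
        (\<lambda>\<omega>. x k \<omega> - (\<alpha>0 / sqrt (S (Suc k) \<omega>)) *\<^sub>R v k \<omega>) \<in> borel_measurable (F (Suc k))"
      by (intro measurable_cong) (use theta_step[of "Suc k"] in \<open>simp add: x_def v_def space_F\<close>)
    then show ?case by simp
  qed
  interpret objective: smooth_objective g gradg L'
    using gradient g_nonneg lipschitz by unfold_locales (auto simp: L'_def)
  interpret filtered_prob_space M F
  proof
    show "subalgebra M (F k)" for k
      unfolding F_def using xi_M by (intro subalgebra_noise_filtration) auto
    show "sets (F k) \<subseteq> sets (F (Suc k))" for k
      unfolding F_def by (intro sets_noise_filtration_mono) simp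
  qed
  interpret process: adagrad_process g gradg L' M F x v S \<alpha>0 \<sigma>0 \<sigma>1 S0 \<theta>1
  proof (intro adagrad_process.intro adagrad_process_axioms.intro)
    show "adagrad_path g gradg L' (\<lambda>k. x k \<omega>) (\<lambda>k. v k \<omega>) (\<lambda>k. S k \<omega>) \<alpha>0" if "\<omega> \<in> space M" for \<omega>
      using alpha0_pos S0_pos S_0[OF that] S_step[OF _ that] theta_step[OF _ that]
      by unfold_locales (auto simp: x_def v_def simp flip: Suc_eq_plus1)
    show "AE \<omega> in M. vec_cond_exp M (F k) (v k) \<omega> = gradg (x k \<omega>)" for k
      using unbiased[of "Suc k"] by (simp add: F_def x_def v_def)
    show "AE \<omega> in M. nn_cond_exp M (F k) (\<lambda>\<omega>. ennreal ((norm (v k \<omega>))\<^sup>2)) \<omega>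
        \<le> ennreal (\<sigma>0 * (norm (gradg (x k \<omega>)))\<^sup>2 + \<sigma>1)" for k
      using second_moment[of "Suc k"] by (simp add: F_def x_def v_def)
  qed (use objective.smooth_objective_axioms filtered_prob_space_axioms adapted v_if_x theta_1 S_0 sigma_nonneg
      in \<open>auto simp: x_def\<close>)
  have "AE \<omega> in M. adagrad_regular_path g gradg L' (\<lambda>k. x k \<omega>) (\<lambda>k. v k \<omega>) (\<lambda>k. S k \<omega>) \<alpha>0 D0 D1"
    using D_pos bounded_near_critical[of "Suc _"]
    by (intro process.AE_regular_path) (auto simp: x_def v_def)
  then show ?thesis
  proof eventually_elim
    case (elim \<omega>)
    then have "(\<lambda>k. norm (gradg (x k \<omega>))) \<longlonglongrightarrow> 0"
      using eta_pos gradient_liminf coercive critical_values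
      by (intro adagrad_regular_path.gradient_tendsto_0)
    then show ?case
      unfolding x_def by (rule LIMSEQ_imp_Suc)
  qed
qed

end
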